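(* Let $n\ge 3$. The set $\mathbb{M}(n)\subset\mathbb{C}^n$ is an $n$-manifold (real dimension $n$) diffeomorphic to the mapping torus $$\Big(\big(\mathbb{R}^{n-1}\smallsetminus\{\vec 0\}\big)\times[0,\pi]\Big)\Big/\Big\{(X,0)\sim(-X,\pi)\Big\}.$$
   Context: Let $n\ge 3$ and $\mathcal{D}_n=\{(b,\dots,b)\in\mathbb{C}^n : b\in\mathbb{C}\}$. $\mathbb{L}(n)\subset\mathbb{C}^n$ is the set of $n$-segments: points $(z_1,\dots,z_n)\in\mathbb{C}^n\smallsetminus\mathcal{D}_n$ such that $z_1,\dots,z_n$ lie on a common real straight line in $\mathbb{C}$. Let $V_n=\{(0,z_2,\dots,z_n)\in\mathbb{C}^n\}$ and $\mathbb{M}(n)=\mathbb{L}(n)\cap V_n$; equivalently, $\mathbb{M}(n)=\{aX : a\in\mathbb{C}\smallsetminus\{0\},\ X\in (V_n\cap\mathbb{R}^n)\smallsetminus\{\vec 0\}\}$. "Manifold" here means a smooth real submanifold of $\mathbb{C}^n\cong\mathbb{R}^{2n}$. The mapping torus carries its standard smooth structure, as the quotient of $(\mathbb{R}^{n-1}\smallsetminus\{\vec 0\})\times\mathbb{R}$ by the free action of $\mathbb{Z}$ generated by $(X,\theta)\mapsto(-X,\theta+\pi)$. *)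

theory Defs
  imports "HOL-Analysis.Analysis"
begin

section \<open>Smooth maps between open subsets of Euclidean spaces\<close>

text \<open>
  \<open>Ck_on k S f\<close> is meant for open \<open>S\<close>. In finite dimension, \<open>C\<^sup>k\<close>-regularity of the derivative, as a
  map into linear maps, is the same as \<open>C\<^sup>k\<close>-regularity of each of its values
  \<open>x \<mapsto> Df(x) v\<close>; this avoids iterating over types of multilinear maps.
\<close>

primrec Ck_on :: "nat \<Rightarrow> 'a::euclidean_space set \<Rightarrow> ('a \<Rightarrow> 'b::euclidean_space) \<Rightarrow> bool" where
  "Ck_on 0 S f \<longleftrightarrow> continuous_on S f"
| "Ck_on (Suc k) S f \<longleftrightarrow> (\<forall>x\<in>S. f differentiable (at x)) \<and>
     (\<forall>v. Ck_on k S (\<lambda>x. frechet_derivative f (at x) v))"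

definition smooth_on :: "'a::euclidean_space set \<Rightarrow> ('a \<Rightarrow> 'b::euclidean_space) \<Rightarrow> bool" where
  "smooth_on S f \<longleftrightarrow> (\<forall>k. Ck_on k S f)"

definition diffeo_betw ::
  "'a::euclidean_space set \<Rightarrow> 'b::euclidean_space set \<Rightarrow> ('a \<Rightarrow> 'b) \<Rightarrow> bool" where
  "diffeo_betw U V f \<longleftrightarrow> open U \<and> open V \<and> bij_betw f U V \<and>
     smooth_on U f \<and> smooth_on V (inv_into U f)"


section \<open>Smooth manifolds and diffeomorphisms\<close>

text \<open>
  A chart is a pair \<open>(U, \<phi>)\<close>; only the values of \<open>\<phi>\<close> on \<open>U\<close> matter. The Euclidean space
  \<open>'e\<close> is the model space, so the dimension is \<open>DIM('e)\<close>.
\<close>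

type_synonym ('a, 'e) chart = "'a set \<times> ('a \<Rightarrow> 'e)"

definition smooth_atlas :: "'a topology \<Rightarrow> ('a, 'e::euclidean_space) chart set \<Rightarrow> bool" where
  "smooth_atlas X A \<longleftrightarrow>
     (\<Union>(U, \<phi>)\<in>A. U) = topspace X \<and>
     (\<forall>(U, \<phi>)\<in>A. openin X U \<and> open (\<phi> ` U) \<and>
        homeomorphic_map (subtopology X U) (top_of_set (\<phi> ` U)) \<phi>) \<and>
     (\<forall>(U, \<phi>)\<in>A. \<forall>(W, \<psi>)\<in>A. smooth_on (\<phi> ` (U \<inter> W)) (\<psi> \<circ> inv_into U \<phi>))"

definition smooth_manifold :: "'a topology \<Rightarrow> ('a, 'e::euclidean_space) chart set \<Rightarrow> bool" where
  "smooth_manifold X A \<longleftrightarrow> Hausdorff_space X \<and> second_countable X \<and> smooth_atlas X A"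

definition smooth_map ::
  "'a topology \<Rightarrow> ('a, 'e::euclidean_space) chart set \<Rightarrow>
   'b topology \<Rightarrow> ('b, 'f::euclidean_space) chart set \<Rightarrow> ('a \<Rightarrow> 'b) \<Rightarrow> bool" where
  "smooth_map X A Y B f \<longleftrightarrow> continuous_map X Y f \<and>
     (\<forall>(U, \<phi>)\<in>A. \<forall>(W, \<psi>)\<in>B. smooth_on (\<phi> ` (U \<inter> f -` W)) (\<psi> \<circ> f \<circ> inv_into U \<phi>))"

definition diffeomorphic ::
  "'a topology \<Rightarrow> ('a, 'e::euclidean_space) chart set \<Rightarrow>
   'b topology \<Rightarrow> ('b, 'f::euclidean_space) chart set \<Rightarrow> bool" where
  "diffeomorphic X A Y B \<longleftrightarrow> smooth_manifold X A \<and> smooth_manifold Y B \<and>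
     (\<exists>f g. smooth_map X A Y B f \<and> smooth_map Y B X A g \<and>
        (\<forall>x\<in>topspace X. g (f x) = x) \<and> (\<forall>y\<in>topspace Y. f (g y) = y))"


section \<open>Submanifolds of Euclidean space\<close>

text \<open>Embedded submanifolds of dimension \<open>d\<close>, given by slice charts of the ambient space.\<close>

definition smooth_submanifold :: "nat \<Rightarrow> 'a::euclidean_space set \<Rightarrow> bool" where
  "smooth_submanifold d M \<longleftrightarrow>
     (\<forall>p\<in>M. \<exists>U V (\<phi> :: 'a \<Rightarrow> 'a) L. p \<in> U \<and> diffeo_betw U V \<phi> \<and>
        subspace L \<and> dim L = d \<and> \<phi> ` (U \<inter> M) = V \<inter> L)"

text \<open>
  Smoothness on an arbitrary subset of a Euclidean space: locally the restriction of a smooth map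
  of the ambient space.
\<close>

definition smooth_on_subset :: "'a::euclidean_space set \<Rightarrow> ('a \<Rightarrow> 'b::euclidean_space) \<Rightarrow> bool" where
  "smooth_on_subset S f \<longleftrightarrow>
     (\<forall>p\<in>S. \<exists>U g. open U \<and> p \<in> U \<and> smooth_on U g \<and> (\<forall>x\<in>S \<inter> U. g x = f x))"

text \<open>
  The smooth structure that a submanifold inherits from the ambient space: the charts are all
  diffeomorphisms from relatively open subsets onto open subsets of the model space.
\<close>

definition submanifold_atlas :: "'a::euclidean_space set \<Rightarrow> ('a, 'e::euclidean_space) chart set" where
  "submanifold_atlas M =
     {(U, \<phi>). openin (top_of_set M) U \<and> open (\<phi> ` U) \<and> inj_on \<phi> U \<and>
        smooth_on_subset U \<phi> \<and> smooth_on (\<phi> ` U) (inv_into U \<phi>)}"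


section \<open>Segments\<close>

definition diagonal_points :: "(complex ^ 'n) set" where
  "diagonal_points = {z. \<exists>b. \<forall>i. z $ i = b}"

text \<open>\<^const>\<open>collinear\<close> refers to the real vector space structure of \<^typ>\<open>complex\<close>.\<close>

definition segments :: "(complex ^ 'n) set" where
  "segments = {z. z \<notin> diagonal_points \<and> collinear (range (\<lambda>i. z $ i))}"

text \<open>The index \<open>i0\<close> below plays the role of the first coordinate.\<close>

definition based_tuples :: "'n \<Rightarrow> (complex ^ 'n) set" where
  "based_tuples i0 = {z. z $ i0 = 0}"

definition based_segments :: "'n \<Rightarrow> (complex ^ 'n) set" where
  "based_segments i0 = segments \<inter> based_tuples i0"

lemma based_segments_eq:
  fixes i0 :: "'n::finite"
  shows "based_segments i0 =
    {z. \<exists>a x. a \<noteq> 0 \<and> x \<noteq> (0 :: real ^ 'n) \<and> x $ i0 = 0 \<and> z = (\<chi> i. a * complex_of_real (x $ i))}"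
    (is "_ = ?R")
proof (intro equalityI subsetI)
  fix z assume "z \<in> based_segments i0"
  then have z0: "z $ i0 = 0" and nd: "\<And>b. \<exists>i. z $ i \<noteq> b"
    and "collinear (range (\<lambda>i. z $ i))"
    by (auto simp: based_segments_def segments_def based_tuples_def diagonal_points_def)
  then obtain u where "\<forall>i j. \<exists>c. z $ i - z $ j = c *\<^sub>R u"
    by (auto simp: collinear_def)
  then have "\<forall>i. \<exists>c. z $ i = c *\<^sub>R u" using z0 by (metis diff_zero)
  then obtain c where c: "\<And>i. z $ i = c i *\<^sub>R u" by metis
  obtain j where j: "z $ j \<noteq> 0" using nd by blast
  then have u: "u \<noteq> 0" and "c j \<noteq> 0" using c[of j] by auto
  moreover have "c i0 = 0" using c[of i0] z0 u by auto
  moreover from \<open>c j \<noteq> 0\<close> have "(\<chi> i. c i) \<noteq> 0" by (metis vec_lambda_beta zero_index)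
  ultimately show "z \<in> ?R"
    by (intro CollectI exI[of _ u] exI[of _ "\<chi> i. c i"])
       (auto simp: vec_eq_iff c scaleR_conv_of_real mult.commute)
next
  fix z assume "z \<in> ?R"
  then obtain a x where a: "a \<noteq> 0" and x: "x \<noteq> 0" "x $ i0 = 0"
    and z: "z = (\<chi> i. a * complex_of_real (x $ i))" by blast
  obtain j where j: "x $ j \<noteq> 0" using x(1) by (auto simp: vec_eq_iff)
  have "z $ i0 = 0" and "z $ j \<noteq> 0" using a x j by (auto simp: z)
  then have "z \<notin> diagonal_points" unfolding diagonal_points_def by force
  moreover have "collinear (range (\<lambda>i. z $ i))"
    unfolding collinear_def
  proof (intro exI[of _ a] ballI)
    fix p q assume "p \<in> range (($) z)" "q \<in> range (($) z)"
    then obtain i k where "p = z $ i" "q = z $ k" by blast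
    then have "p - q = (x $ i - x $ k) *\<^sub>R a"
      by (simp add: z scaleR_conv_of_real algebra_simps)
    then show "\<exists>c. p - q = c *\<^sub>R a" ..
  qed
  ultimately show "z \<in> based_segments i0"
    using \<open>z $ i0 = 0\<close> by (simp add: based_segments_def segments_def based_tuples_def)
qed


section \<open>The mapping torus\<close>

definition quotient_topology :: "'a topology \<Rightarrow> ('a \<times> 'a) set \<Rightarrow> 'a set topology" where
  "quotient_topology X r = topology (\<lambda>W. W \<subseteq> topspace X // r \<and> openin X (\<Union>W))"

lemma openin_quotient_topology:
  assumes "equiv (topspace X) r"
  shows "openin (quotient_topology X r) W \<longleftrightarrow> W \<subseteq> topspace X // r \<and> openin X (\<Union>W)"
proof -
  have "istopology (\<lambda>W. W \<subseteq> topspace X // r \<and> openin X (\<Union>W))"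
    unfolding istopology_def
  proof (intro conjI allI impI)
    fix S T
    assume S: "S \<subseteq> topspace X // r \<and> openin X (\<Union>S)"
      and T: "T \<subseteq> topspace X // r \<and> openin X (\<Union>T)"
    then show "S \<inter> T \<subseteq> topspace X // r" by blast
    have "\<Union>(S \<inter> T) = \<Union>S \<inter> \<Union>T"
    proof (intro equalityI subsetI)
      fix x assume "x \<in> \<Union>S \<inter> \<Union>T"
      then obtain A B where "A \<in> S" "B \<in> T" "x \<in> A" "x \<in> B" by blast
      moreover have "A = B"
        using quotient_disj[OF assms, of A B] S T calculation by blast
      ultimately show "x \<in> \<Union>(S \<inter> T)" by blast
    qed blast
    then show "openin X (\<Union>(S \<inter> T))" using S T by (simp add: openin_Int)
  next
    fix K
    assume K: "\<forall>S\<in>K. S \<subseteq> topspace X // r \<and> openin X (\<Union>S)"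
    then show "\<Union>K \<subseteq> topspace X // r" by blast
    have "\<Union>(\<Union>K) = (\<Union>S\<in>K. \<Union>S)" by blast
    then show "openin X (\<Union>(\<Union>K))" using K by auto
  qed
  then show ?thesis by (simp add: quotient_topology_def)
qed

text \<open>Throughout, \<open>CARD('m)\<close> is the number \<open>n - 1\<close>.\<close>

definition torus_strip :: "((real ^ 'm) \<times> real) set" where
  "torus_strip = (UNIV - {0}) \<times> {0..pi}"

definition torus_glue :: "(((real ^ 'm) \<times> real) \<times> ((real ^ 'm) \<times> real)) set" where
  "torus_glue = {(p, q). p \<in> torus_strip \<and> q \<in> torus_strip \<and>
     (p = q \<or> (\<exists>X. p = (X, 0) \<and> q = (- X, pi)) \<or> (\<exists>X. q = (X, 0) \<and> p = (- X, pi)))}"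

lemma equiv_torus_glue: "equiv torus_strip torus_glue"
  by (rule equivI) (auto simp: torus_glue_def refl_on_def sym_def trans_def)

definition mapping_torus :: "((real ^ 'm) \<times> real) set topology" where
  "mapping_torus = quotient_topology (top_of_set torus_strip) torus_glue"

lemma openin_mapping_torus:
  "openin mapping_torus W \<longleftrightarrow>
     W \<subseteq> torus_strip // torus_glue \<and> openin (top_of_set torus_strip) (\<Union>W)"
  using openin_quotient_topology[of "top_of_set torus_strip" torus_glue W] equiv_torus_glue
  by (simp add: mapping_torus_def)

lemma topspace_mapping_torus: "topspace mapping_torus = torus_strip // torus_glue"
proof
  show "topspace mapping_torus \<subseteq> torus_strip // torus_glue"
    using openin_topspace openin_mapping_torus by blast
  have "openin mapping_torus (torus_strip // torus_glue)"
    by (simp add: openin_mapping_torus Union_quotient[OF equiv_torus_glue])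
  then show "torus_strip // torus_glue \<subseteq> topspace mapping_torus"
    by (rule openin_subset)
qed

definition torus_cover :: "((real ^ 'm) \<times> real) set" where
  "torus_cover = (UNIV - {0}) \<times> UNIV"

text \<open>The action of \<open>k \<in> \<int>\<close>, generated by \<open>(X, \<theta>) \<mapsto> (- X, \<theta> + \<pi>)\<close>.\<close>

definition torus_deck :: "int \<Rightarrow> (real ^ 'm) \<times> real \<Rightarrow> (real ^ 'm) \<times> real" where
  "torus_deck k = (\<lambda>(X, \<theta>). (((-1) powi k) *\<^sub>R X, \<theta> + of_int k * pi))"

text \<open>
  The strip contains a fundamental domain, and each orbit meets the strip in exactly one gluing
  class. So the orbit space is identified with the glued strip via the following projection.
\<close>

definition torus_proj :: "(real ^ 'm) \<times> real \<Rightarrow> ((real ^ 'm) \<times> real) set" where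
  "torus_proj p = range (\<lambda>k. torus_deck k p) \<inter> torus_strip"

text \<open>
  The smooth structure of the quotient by the action: the charts are the inverses of
  the projection on open sets where it is injective.
\<close>

definition mapping_torus_atlas ::
  "(((real ^ 'm) \<times> real) set, (real ^ 'm) \<times> real) chart set" where
  "mapping_torus_atlas =
     {(torus_proj ` V, inv_into V torus_proj) | V. open V \<and> V \<subseteq> torus_cover \<and> inj_on torus_proj V}"

lemma torus_deck_add: "torus_deck (j + k) p = torus_deck j (torus_deck k p)"
  by (cases p) (simp add: torus_deck_def power_int_add algebra_simps)

lemma torus_deck_0: "torus_deck 0 p = p"
  by (cases p) (simp add: torus_deck_def)

lemma torus_deck_in_cover: "p \<in> torus_cover \<Longrightarrow> torus_deck k p \<in> torus_cover"
  by (cases p) (auto simp: torus_deck_def torus_cover_def)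

lemma torus_deck_meets_strip:
  assumes "p \<in> torus_cover"
  shows "\<exists>k. torus_deck k p \<in> torus_strip"
proof -
  obtain X t where p: "p = (X, t)" "X \<noteq> 0"
    using assms by (cases p) (auto simp: torus_cover_def)
  define k where "k = \<lfloor>t / pi\<rfloor>"
  have "of_int k \<le> t / pi" "t / pi < of_int k + 1" by (auto simp: k_def)
  then have "of_int k * pi \<le> t" "t \<le> (of_int k + 1) * pi"
    by (simp_all add: field_simps)
  then have "torus_deck (- k) p \<in> torus_strip"
    by (auto simp: p torus_deck_def torus_strip_def algebra_simps)
  then show ?thesis ..
qed

lemma torus_proj_eq_iff:
  assumes "q \<in> torus_cover"
  shows "torus_proj p = torus_proj q \<longleftrightarrow> (\<exists>k. q = torus_deck k p)"
proof
  assume eq: "torus_proj p = torus_proj q"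
  obtain k where "torus_deck k q \<in> torus_strip"
    using torus_deck_meets_strip[OF assms] ..
  then have "torus_deck k q \<in> torus_proj q" unfolding torus_proj_def by blast
  then have "torus_deck k q \<in> torus_proj p" by (simp add: eq)
  then obtain j where "torus_deck k q = torus_deck j p" by (auto simp: torus_proj_def)
  then have "torus_deck (- k + k) q = torus_deck (- k + j) p" by (simp only: torus_deck_add)
  then show "\<exists>k. q = torus_deck k p" by (auto simp: torus_deck_0)
next
  assume "\<exists>k. q = torus_deck k p"
  then obtain k where q: "q = torus_deck k p" ..
  have "range (\<lambda>j. torus_deck j p) = range (\<lambda>j. torus_deck j q)"
  proof (intro equalityI image_subsetI)
    fix j
    have "torus_deck j p = torus_deck (j - k) q" by (simp only: q torus_deck_add[symmetric] diff_add_cancel)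
    then show "torus_deck j p \<in> range (\<lambda>j. torus_deck j q)" by blast
  next
    fix j
    have "torus_deck j q = torus_deck (j + k) p" by (simp only: q torus_deck_add)
    then show "torus_deck j q \<in> range (\<lambda>j. torus_deck j p)" by blast
  qed
  then show "torus_proj p = torus_proj q" by (simp add: torus_proj_def)
qed

lemma torus_proj_strip:
  assumes "p \<in> torus_strip"
  shows "torus_proj p = torus_glue `` {p}"
proof (intro equalityI subsetI)
  fix q assume "q \<in> torus_proj p"
  then obtain k where q: "q = torus_deck k p" "q \<in> torus_strip" by (auto simp: torus_proj_def)
  obtain X t where p: "p = (X, t)" "X \<noteq> 0" "0 \<le> t" "t \<le> pi"
    using assms by (cases p) (auto simp: torus_strip_def)
  have b: "0 \<le> t + of_int k * pi" "t + of_int k * pi \<le> pi"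
    using q by (auto simp: p torus_deck_def torus_strip_def)
  have "- pi \<le> of_int k * pi" "of_int k * pi \<le> pi" using b p by linarith+
  then have "(-1) * pi \<le> of_int k * pi" "of_int k * pi \<le> 1 * pi" by simp_all
  then have "-1 \<le> real_of_int k" "real_of_int k \<le> 1"
    by (simp_all only: mult_le_cancel_right_pos pi_gt_zero)
  then consider "k = 0" | "k = 1" | "k = -1" by linarith
  then show "q \<in> torus_glue `` {p}"
  proof cases
    case 1 then show ?thesis using assms q by (simp add: torus_glue_def torus_deck_0)
  next
    case 2
    then have "t = 0" using b p by simp
    then show ?thesis using assms q 2 by (simp add: torus_glue_def torus_deck_def p)
  next
    case 3
    then have "t = pi" using b p by simp
    then show ?thesis using assms q 3 by (simp add: torus_glue_def torus_deck_def p)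
  qed
next
  fix q assume "q \<in> torus_glue `` {p}"
  then have q: "q \<in> torus_strip" and
    "p = q \<or> (\<exists>X. p = (X, 0) \<and> q = (- X, pi)) \<or> (\<exists>X. q = (X, 0) \<and> p = (- X, pi))"
    by (auto simp: torus_glue_def)
  then have "q = torus_deck 0 p \<or> q = torus_deck 1 p \<or> q = torus_deck (- 1) p"
    by (auto simp: torus_deck_def)
  then show "q \<in> torus_proj p" using q by (auto simp: torus_proj_def)
qed

lemma torus_proj_image: "torus_proj ` torus_cover = torus_strip // torus_glue"
proof (intro equalityI subsetI)
  fix c assume "c \<in> torus_proj ` torus_cover"
  then obtain p where p: "p \<in> torus_cover" "c = torus_proj p" by blast
  then obtain k where k: "torus_deck k p \<in> torus_strip" using torus_deck_meets_strip by blast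
  then have "c = torus_proj (torus_deck k p)"
    using p torus_proj_eq_iff torus_deck_in_cover by blast
  then show "c \<in> torus_strip // torus_glue" using k by (auto simp: torus_proj_strip quotient_def)
next
  fix c assume "c \<in> torus_strip // torus_glue"
  then obtain p where p: "p \<in> torus_strip" "c = torus_proj p"
    by (auto simp: torus_proj_strip quotient_def)
  then have "p \<in> torus_cover" by (auto simp: torus_strip_def torus_cover_def)
  then show "c \<in> torus_proj ` torus_cover" using p by blast
qed

end

theory Submission
  imports Defs
begin

text \<open>
  The map \<open>(X, \<theta>) \<mapsto> e\<^sup>i\<^sup>\<theta> X\<close> sends the cover \<open>(\<real>\<^sup>n\<^sup>-\<^sup>1 - {0}) \<times> \<real>\<close> onto the based segments, and its
  fibres are exactly the orbits of the deck group. Near the image of a point with \<open>X\<^sub>j \<noteq> 0\<close> it has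
  a smooth left inverse defined on an open set of the ambient space: up to a constant, the angle is the
  argument of the \<open>j\<close>-th coordinate, and \<open>X\<close> is obtained by rotating back by that angle. Therefore all
  chart comparisons reduce to compositions of these local inverses with smooth maps.
  The slice charts for the submanifold property are \<open>z \<mapsto> (z\<^sub>k / z\<^sub>j)\<^sub>k\<close> with \<open>z\<^sub>j\<close> itself kept in
  position \<open>j\<close>; they turn the based segments into a linear condition.
\<close>

section \<open>Calculus of smooth maps\<close>

text \<open>The torus is given in two ways that do not match directly: its topology is the quotient
  of the closed strip, where two ends are glued, while its charts invert the projection from the
  whole cover. The comparison goes through the parametrization, which has the same fibres on the
  cover as \<open>torus_proj\<close>. Injectivity and coordinate expressions can therefore be
  computed with \<open>seg_param\<close>, and the Hausdorff property and second countability are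
  inherited from a subset of Euclidean space instead of being checked at the seam. The local
  inverses live on ambient open sets because \<open>smooth_on_subset\<close> asks for ambient
  extensions. Since these sets meet the based segments exactly in the image of an open part of the
  cover, the parametrization is also an open map onto its image; the homeomorphism rests on this.
  \<open>Ck_on\<close> iterates derivatives in fixed directions, so products and compositions are
  treated by induction on the order, with an explicit formula for the derivative at each
  step.\<close>

lemma frechet_derivative_eq:
  "(f has_derivative f') (at x) \<Longrightarrow> frechet_derivative f (at x) = f'"
  by (metis frechet_derivative_at)

text \<open>\<open>frechet_derivative\<close> is a choice among the maps satisfying
  \<open>has_derivative\<close>. The same candidates qualify for both functions, so the choices
  coincide even at points without a derivative.\<close>

lemma frechet_derivative_cong_open:
  assumes "open S" "x \<in> S" "\<And>y. y \<in> S \<Longrightarrow> f y = g y"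
  shows "frechet_derivative f (at x) = frechet_derivative g (at x)"
proof -
  have "(f has_derivative D) (at x) \<longleftrightarrow> (g has_derivative D) (at x)" for D
    using has_derivative_transform_within_open[of f D x UNIV S g]
      has_derivative_transform_within_open[of g D x UNIV S f] assms by metis
  then show ?thesis by (simp add: frechet_derivative_def)
qed

lemma Ck_on_cong_imp:
  assumes "open S" "\<And>y. y \<in> S \<Longrightarrow> f y = g y" "Ck_on k S f"
  shows "Ck_on k S g"
  using assms
proof (induction k arbitrary: f g)
  case 0
  have "continuous_on S g"
    by (rule continuous_on_eq[OF 0(3)[unfolded Ck_on.simps(1)] 0(2)])
  then show ?case unfolding Ck_on.simps(1) .
next
  case (Suc k)
  have "g differentiable (at x)" if "x \<in> S" for x
  proof -
    have "f differentiable (at x)" using Suc.prems(3) that by simp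
    then obtain D where "(f has_derivative D) (at x)" unfolding differentiable_def ..
    then have "(g has_derivative D) (at x)"
      by (rule has_derivative_transform_within_open[OF _ Suc.prems(1) that Suc.prems(2)])
    then show ?thesis by (rule differentiableI)
  qed
  moreover have "Ck_on k S (\<lambda>x. frechet_derivative g (at x) v)" for v
  proof (rule Suc.IH[OF Suc.prems(1)])
    show "frechet_derivative f (at x) v = frechet_derivative g (at x) v" if "x \<in> S" for x
      using frechet_derivative_cong_open[OF Suc.prems(1) that Suc.prems(2)] by simp
    show "Ck_on k S (\<lambda>x. frechet_derivative f (at x) v)" using Suc.prems(3) by simp
  qed
  ultimately show ?case by simp
qed

lemma Ck_on_cong:
  assumes "open S" "\<And>y. y \<in> S \<Longrightarrow> f y = g y"
  shows "Ck_on k S f \<longleftrightarrow> Ck_on k S g"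
  using Ck_on_cong_imp assms by metis

lemma Ck_on_subset: "Ck_on k S f \<Longrightarrow> T \<subseteq> S \<Longrightarrow> Ck_on k T f"
  by (induction k arbitrary: f) (auto intro: continuous_on_subset)

text \<open>Smoothness on a general subset supplies ambient extensions only point by point; this
  lemma assembles what they give locally.\<close>

lemma Ck_on_local:
  assumes "\<And>p. p \<in> S \<Longrightarrow> \<exists>U. open U \<and> p \<in> U \<and> Ck_on k U f"
  shows "Ck_on k S f"
  using assms
proof (induction k arbitrary: f)
  case 0
  have "isCont f p" if "p \<in> S" for p
    using 0[OF that] by (auto simp: continuous_on_eq_continuous_at)
  then show ?case by (simp add: continuous_at_imp_continuous_on)
next
  case (Suc k)
  have "f differentiable (at p)" if "p \<in> S" for p using Suc.prems[OF that] by auto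
  moreover have "Ck_on k S (\<lambda>x. frechet_derivative f (at x) v)" for v
  proof (rule Suc.IH)
    fix p assume "p \<in> S"
    then obtain U where "open U" "p \<in> U" "Ck_on (Suc k) U f" using Suc.prems by blast
    then show "\<exists>U. open U \<and> p \<in> U \<and> Ck_on k U (\<lambda>x. frechet_derivative f (at x) v)"
      by auto
  qed
  ultimately show ?case by simp
qed

text \<open>By uniqueness of derivatives an explicit family \<open>f'\<close> may replace the chosen
  derivative in the recursion, so that the inductions below can work with formulas.\<close>

lemma Ck_on_SucI:
  assumes "open S" "\<And>x. x \<in> S \<Longrightarrow> (f has_derivative f' x) (at x)"
    "\<And>v. Ck_on k S (\<lambda>x. f' x v)"
  shows "Ck_on (Suc k) S f"
proof -
  have "Ck_on k S (\<lambda>x. frechet_derivative f (at x) v)" for v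
    by (rule Ck_on_cong_imp[OF assms(1) _ assms(3)[of v]])
       (simp add: frechet_derivative_eq[OF assms(2)])
  moreover have "f differentiable (at x)" if "x \<in> S" for x
    using assms(2)[OF that] by (rule differentiableI)
  ultimately show ?thesis unfolding Ck_on.simps by blast
qed

lemma Ck_on_SucD:
  assumes "Ck_on (Suc k) S f"
  obtains f' where "\<And>x. x \<in> S \<Longrightarrow> (f has_derivative f' x) (at x)"
    "\<And>v. Ck_on k S (\<lambda>x. f' x v)"
proof (rule that[of "\<lambda>x. frechet_derivative f (at x)"])
  show "(f has_derivative frechet_derivative f (at x)) (at x)" if "x \<in> S" for x
    using assms that by (simp add: frechet_derivative_works)
  show "Ck_on k S (\<lambda>x. frechet_derivative f (at x) v)" for v
    using assms by simp
qed

lemma Ck_on_imp_continuous_on: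
  assumes "Ck_on k S f"
  shows "continuous_on S f"
proof (cases k)
  case (Suc l)
  then have "\<forall>x\<in>S. isCont f x" using assms differentiable_imp_continuous_within by auto
  then show ?thesis by (simp add: continuous_at_imp_continuous_on)
qed (use assms in simp)

text \<open>Derivatives of products and composites still contain the original functions, which the
  induction then uses at one order less.\<close>

lemma Ck_on_Suc_imp: "Ck_on (Suc k) S f \<Longrightarrow> Ck_on k S f"
proof (induction k arbitrary: f)
  case 0
  then show ?case using Ck_on_imp_continuous_on by (metis Ck_on.simps(1))
next
  case (Suc k)
  have "Ck_on k S (\<lambda>x. frechet_derivative f (at x) v)" for v
    by (rule Suc.IH) (use Suc.prems in \<open>metis Ck_on.simps(2)\<close>)
  then show ?case using Suc.prems unfolding Ck_on.simps(2)[of k] Ck_on.simps(2)[of "Suc k"] by blast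
qed

lemma Ck_on_const: "Ck_on k S (\<lambda>x. c)"
  by (induction k arbitrary: c) auto

lemma Ck_on_add:
  assumes "open S" "Ck_on k S f" "Ck_on k S g"
  shows "Ck_on k S (\<lambda>x. f x + g x)"
  using assms
proof (induction k arbitrary: f g)
  case 0
  then show ?case by (simp add: continuous_on_add)
next
  case (Suc k)
  obtain f' where f': "\<And>x. x \<in> S \<Longrightarrow> (f has_derivative f' x) (at x)"
    "\<And>v. Ck_on k S (\<lambda>x. f' x v)" using Ck_on_SucD[OF Suc.prems(2)] by blast
  obtain g' where g': "\<And>x. x \<in> S \<Longrightarrow> (g has_derivative g' x) (at x)"
    "\<And>v. Ck_on k S (\<lambda>x. g' x v)" using Ck_on_SucD[OF Suc.prems(3)] by blast
  show ?case
  proof (rule Ck_on_SucI[where f' = "\<lambda>x v. f' x v + g' x v"])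
    show "((\<lambda>x. f x + g x) has_derivative (\<lambda>v. f' x v + g' x v)) (at x)"
      if "x \<in> S" for x using has_derivative_add[OF f'(1)[OF that] g'(1)[OF that]] .
    show "Ck_on k S (\<lambda>x. f' x v + g' x v)" for v
      by (intro Suc.IH Suc.prems(1) f'(2) g'(2))
  qed (rule Suc.prems(1))
qed

lemma Ck_on_sum:
  assumes "open S" "\<And>i. i \<in> I \<Longrightarrow> Ck_on k S (f i)"
  shows "Ck_on k S (\<lambda>x. \<Sum>i\<in>I. f i x)"
  using assms(2)
proof (induction I rule: infinite_finite_induct)
  case (insert i I)
  then show ?case using Ck_on_add[OF assms(1), of k "f i" "\<lambda>x. \<Sum>i\<in>I. f i x"] by simp
qed (simp_all add: Ck_on_const)

text \<open>A single induction on the product rule serves multiplication, scaling and the inner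
  product.\<close>

lemma Ck_on_bilinear:
  assumes h: "bounded_bilinear h" and "open S" "Ck_on k S f" "Ck_on k S g"
  shows "Ck_on k S (\<lambda>x. h (f x) (g x))"
  using assms(2-)
proof (induction k arbitrary: f g)
  case 0
  then show ?case using bounded_bilinear.continuous_on[OF h] by auto
next
  case (Suc k)
  obtain f' where f': "\<And>x. x \<in> S \<Longrightarrow> (f has_derivative f' x) (at x)"
    "\<And>v. Ck_on k S (\<lambda>x. f' x v)" using Ck_on_SucD[OF Suc.prems(2)] by blast
  obtain g' where g': "\<And>x. x \<in> S \<Longrightarrow> (g has_derivative g' x) (at x)"
    "\<And>v. Ck_on k S (\<lambda>x. g' x v)" using Ck_on_SucD[OF Suc.prems(3)] by blast
  have f: "Ck_on k S f" and g: "Ck_on k S g" using Suc.prems Ck_on_Suc_imp by blast+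
  show ?case
  proof (rule Ck_on_SucI[where f' = "\<lambda>x v. h (f x) (g' x v) + h (f' x v) (g x)"])
    show "((\<lambda>x. h (f x) (g x)) has_derivative (\<lambda>v. h (f x) (g' x v) + h (f' x v) (g x))) (at x)"
      if "x \<in> S" for x using bounded_bilinear.FDERIV[OF h f'(1)[OF that] g'(1)[OF that]] .
    show "Ck_on k S (\<lambda>x. h (f x) (g' x v) + h (f' x v) (g x))" for v
      by (intro Ck_on_add Suc.IH Suc.prems(1) f g f'(2) g'(2))
  qed (rule Suc.prems(1))
qed

lemma Ck_on_linear:
  assumes "bounded_linear h" "open S"
  shows "Ck_on k S h"
proof (cases k)
  case 0
  then show ?thesis using assms linear_continuous_on by auto
next
  case (Suc l)
  then show ?thesis using assms
    by (auto intro!: Ck_on_SucI[where f' = "\<lambda>x. h"] bounded_linear_imp_has_derivative Ck_on_const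
        simp del: Ck_on.simps)
qed

lemma Ck_on_compose:
  assumes "open S" "open T" "f ` S \<subseteq> T" "Ck_on k S f" "Ck_on k T g"
  shows "Ck_on k S (\<lambda>x. g (f x))"
  using assms(4-)
proof (induction k arbitrary: g)
  case 0
  then show ?case using continuous_on_compose2[of T g S f] assms by auto
next
  case (Suc k)
  obtain f' where f': "\<And>x. x \<in> S \<Longrightarrow> (f has_derivative f' x) (at x)"
    "\<And>v. Ck_on k S (\<lambda>x. f' x v)" using Ck_on_SucD[OF Suc.prems(1)] by blast
  obtain g' where g': "\<And>x. x \<in> T \<Longrightarrow> (g has_derivative g' x) (at x)"
    "\<And>v. Ck_on k T (\<lambda>x. g' x v)" using Ck_on_SucD[OF Suc.prems(2)] by blast
  have f: "Ck_on k S f" using Suc.prems Ck_on_Suc_imp by blast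
  \<comment> \<open>The direction \<open>f' x v\<close> depends on \<open>x\<close>; expanding it in a basis leaves only fixed directions for \<open>g'\<close>.\<close>
  have "((\<lambda>x. g (f x)) has_derivative (\<lambda>v. \<Sum>b\<in>Basis. (f' x v \<bullet> b) *\<^sub>R g' (f x) b)) (at x)"
    if x: "x \<in> S" for x
  proof -
    have fx: "(g has_derivative g' (f x)) (at (f x))" using g' assms(3) x by auto
    then have lin: "linear (g' (f x))" by (rule has_derivative_linear)
    have eq: "g' (f x) w = (\<Sum>b\<in>Basis. (w \<bullet> b) *\<^sub>R g' (f x) b)" for w
    proof -
      have "g' (f x) w = g' (f x) (\<Sum>b\<in>Basis. (w \<bullet> b) *\<^sub>R b)" by (simp add: euclidean_representation)
      then show ?thesis by (simp add: linear_sum[OF lin] linear_scale[OF lin])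
    qed
    show ?thesis
      using has_derivative_compose[OF f'(1)[OF x] fx] unfolding eq[of "f' x _"] .
  qed
  moreover have "Ck_on k S (\<lambda>x. \<Sum>b\<in>Basis. (f' x v \<bullet> b) *\<^sub>R g' (f x) b)" for v
    by (intro Ck_on_sum assms(1) Ck_on_bilinear[OF bounded_bilinear_scaleR] Suc.IH f g'(2)
        Ck_on_bilinear[OF bounded_bilinear_inner] f'(2) Ck_on_const)
  ultimately show ?case
    by (rule Ck_on_SucI[OF assms(1),
          where f' = "\<lambda>x v. \<Sum>b\<in>Basis. (f' x v \<bullet> b) *\<^sub>R g' (f x) b"])
qed

text \<open>The derivative is a polynomial in \<open>inverse x\<close> itself, so regularity of
  order \<open>k\<close> yields order \<open>k + 1\<close>. The same bootstrapping works for
  \<open>cis\<close>.\<close>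

lemma Ck_on_inverse:
  "Ck_on k (- {0}) (inverse :: 'a::{real_normed_field, euclidean_space} \<Rightarrow> 'a)"
proof (induction k)
  case 0
  show ?case by (auto intro!: continuous_intros)
next
  case (Suc k)
  have "Ck_on k (- {0::'a}) (\<lambda>x. (- 1) * ((inverse x * v) * inverse x))" for v
    by (intro Ck_on_bilinear[OF bounded_bilinear_mult] Suc.IH Ck_on_const open_Compl) auto
  then show ?case
    by (intro Ck_on_SucI[where f' = "\<lambda>x v. (- 1) * ((inverse x * v) * inverse x)"])
       (auto intro: has_derivative_inverse')
qed

lemma Ck_on_cis: "Ck_on k UNIV cis"
proof (induction k)
  case 0
  show ?case by (auto intro!: continuous_intros)
next
  case (Suc k)
  have "Ck_on k UNIV (\<lambda>t. v *\<^sub>R (\<i> * cis t))" for v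
    by (intro Ck_on_bilinear[OF bounded_bilinear_scaleR] Ck_on_bilinear[OF bounded_bilinear_mult]
        Suc.IH Ck_on_const open_UNIV)
  moreover have "(cis has_derivative (\<lambda>v. v *\<^sub>R (\<i> * cis t))) (at t)" for t
    by (rule has_derivative_cis[OF has_derivative_ident])
  ultimately show ?case
    by (intro Ck_on_SucI[where f' = "\<lambda>t v. v *\<^sub>R (\<i> * cis t)"]) auto
qed

text \<open>One differentiation leads to \<open>inverse\<close>, whose regularity is already known;
  hence a case split in place of an induction.\<close>

lemma Ck_on_Ln: "Ck_on k (- \<real>\<^sub>\<le>\<^sub>0) Ln"
proof (cases k)
  case 0
  show ?thesis using 0 by (auto intro!: continuous_intros)
next
  case (Suc l)
  have o: "open (- \<real>\<^sub>\<le>\<^sub>0 :: complex set)" by (simp add: open_Compl)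
  have "Ck_on l (- \<real>\<^sub>\<le>\<^sub>0) (\<lambda>z::complex. inverse z * v)" for v
    by (intro Ck_on_bilinear[OF bounded_bilinear_mult] o Ck_on_const
        Ck_on_subset[OF Ck_on_inverse]) auto
  then show ?thesis unfolding Suc
    by (intro Ck_on_SucI[where f' = "\<lambda>z v. inverse z * v"] o)
       (auto simp: has_field_derivative_def[symmetric] intro!: has_field_derivative_Ln)
qed

section \<open>Closure properties of smooth maps\<close>

lemma smooth_on_cong:
  "open S \<Longrightarrow> (\<And>y. y \<in> S \<Longrightarrow> f y = g y) \<Longrightarrow> smooth_on S f \<longleftrightarrow> smooth_on S g"
  unfolding smooth_on_def using Ck_on_cong by metis

lemma smooth_on_subset: "smooth_on S f \<Longrightarrow> T \<subseteq> S \<Longrightarrow> smooth_on T f"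
  unfolding smooth_on_def using Ck_on_subset by metis

lemma smooth_on_local:
  assumes "\<And>p. p \<in> S \<Longrightarrow> \<exists>U. open U \<and> p \<in> U \<and> smooth_on U f"
  shows "smooth_on S f"
  unfolding smooth_on_def
proof
  fix k
  show "Ck_on k S f"
    by (rule Ck_on_local) (use assms in \<open>unfold smooth_on_def, blast\<close>)
qed

lemma smooth_on_imp_continuous_on: "smooth_on S f \<Longrightarrow> continuous_on S f"
  unfolding smooth_on_def using Ck_on_imp_continuous_on by blast

lemma smooth_on_const: "smooth_on S (\<lambda>x. c)"
  by (simp add: smooth_on_def Ck_on_const)

lemma smooth_on_add:
  "open S \<Longrightarrow> smooth_on S f \<Longrightarrow> smooth_on S g \<Longrightarrow> smooth_on S (\<lambda>x. f x + g x)"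
  by (simp add: smooth_on_def Ck_on_add)

lemma smooth_on_sum:
  "open S \<Longrightarrow> (\<And>i. i \<in> I \<Longrightarrow> smooth_on S (f i)) \<Longrightarrow> smooth_on S (\<lambda>x. \<Sum>i\<in>I. f i x)"
  by (simp add: smooth_on_def Ck_on_sum)

lemma smooth_on_mult:
  fixes f g :: "'a::euclidean_space \<Rightarrow> 'b::{real_normed_field, euclidean_space}"
  shows "open S \<Longrightarrow> smooth_on S f \<Longrightarrow> smooth_on S g \<Longrightarrow> smooth_on S (\<lambda>x. f x * g x)"
  by (simp add: smooth_on_def Ck_on_bilinear[OF bounded_bilinear_mult])

lemma smooth_on_compose:
  "open S \<Longrightarrow> open T \<Longrightarrow> f ` S \<subseteq> T \<Longrightarrow> smooth_on S f \<Longrightarrow> smooth_on T g \<Longrightarrow>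
    smooth_on S (\<lambda>x. g (f x))"
  unfolding smooth_on_def using Ck_on_compose by blast

lemma smooth_on_linear: "bounded_linear h \<Longrightarrow> open S \<Longrightarrow> smooth_on S h"
  by (simp add: smooth_on_def Ck_on_linear)

lemma smooth_on_linear_compose:
  assumes "bounded_linear h" "open S" "smooth_on S f"
  shows "smooth_on S (\<lambda>x. h (f x))"
  using smooth_on_compose[OF assms(2) open_UNIV _ assms(3) smooth_on_linear[OF assms(1)]] by simp

lemma smooth_on_inverse:
  fixes f :: "'a::euclidean_space \<Rightarrow> 'b::{real_normed_field, euclidean_space}"
  assumes "open S" "smooth_on S f" "\<And>x. x \<in> S \<Longrightarrow> f x \<noteq> 0"
  shows "smooth_on S (\<lambda>x. inverse (f x))"
proof (rule smooth_on_compose[OF assms(1) _ _ assms(2)])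
  show "smooth_on (- {0}) (inverse :: 'b \<Rightarrow> 'b)" by (simp add: smooth_on_def Ck_on_inverse)
qed (use assms(3) in auto)

lemma smooth_on_divide:
  fixes f g :: "'a::euclidean_space \<Rightarrow> 'b::{real_normed_field, euclidean_space}"
  assumes "open S" "smooth_on S f" "smooth_on S g" "\<And>x. x \<in> S \<Longrightarrow> g x \<noteq> 0"
  shows "smooth_on S (\<lambda>x. f x / g x)"
  unfolding divide_inverse by (intro smooth_on_mult smooth_on_inverse assms)

lemma smooth_on_cis: "open S \<Longrightarrow> smooth_on S f \<Longrightarrow> smooth_on S (\<lambda>x. cis (f x))"
  by (rule smooth_on_compose[OF _ open_UNIV]) (auto simp: smooth_on_def Ck_on_cis)

lemma smooth_on_Ln:
  assumes "open S" "smooth_on S f" "\<And>x. x \<in> S \<Longrightarrow> f x \<notin> \<real>\<^sub>\<le>\<^sub>0"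
  shows "smooth_on S (\<lambda>x. Ln (f x))"
  by (rule smooth_on_compose[OF assms(1) _ _ assms(2), of "- \<real>\<^sub>\<le>\<^sub>0"])
     (use assms(3) in \<open>auto simp: smooth_on_def Ck_on_Ln open_Compl\<close>)

text \<open>A vector is the sum of its entries placed by the linear maps \<open>axis i\<close>,
  which reduces the claim to sums and linear maps.\<close>

lemma smooth_on_vec_lambda:
  fixes f :: "'n::finite \<Rightarrow> 'a::euclidean_space \<Rightarrow> 'b::euclidean_space"
  assumes "open S" "\<And>i. smooth_on S (f i)"
  shows "smooth_on S (\<lambda>x. \<chi> i. f i x)"
proof -
  have "smooth_on S (\<lambda>x. \<Sum>i\<in>UNIV. axis i (f i x))"
  proof (intro smooth_on_sum smooth_on_linear_compose[where h = "axis _"] assms)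
    have "linear (axis i :: 'b \<Rightarrow> 'b ^ 'n)" for i
      by (rule linearI) (auto simp: axis_def vec_eq_iff)
    then show "bounded_linear (axis i :: 'b \<Rightarrow> 'b ^ 'n)" for i
      by (rule linear_conv_bounded_linear[THEN iffD1])
  qed
  moreover have "(\<Sum>i\<in>UNIV. axis i (f i x)) = (\<chi> i. f i x)" for x
    by (simp add: vec_eq_iff axis_def)
  ultimately show ?thesis by simp
qed

lemma smooth_on_Pair:
  assumes "open S" "smooth_on S f" "smooth_on S g"
  shows "smooth_on S (\<lambda>x. (f x, g x))"
proof -
  have "smooth_on S (\<lambda>x. (f x, 0) + (0, g x))"
    by (intro smooth_on_add assms smooth_on_linear_compose[where h = "\<lambda>y. (y, 0)"]
        smooth_on_linear_compose[where h = "\<lambda>y. (0, y)"] bounded_linear_intros)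
  then show ?thesis by simp
qed

section \<open>Smoothness on arbitrary subsets\<close>

lemma smooth_on_subset_imp_continuous_on:
  assumes "smooth_on_subset S f"
  shows "continuous_on S f"
proof -
  have "(f \<longlongrightarrow> f p) (at p within S)" if p: "p \<in> S" for p
  proof -
    obtain U g where U: "open U" "p \<in> U" "smooth_on U g" and eq: "\<And>x. x \<in> S \<inter> U \<Longrightarrow> g x = f x"
      using assms p by (auto simp: smooth_on_subset_def)
    have "isCont g p"
      using U smooth_on_imp_continuous_on continuous_on_eq_continuous_at by blast
    then have "(g \<longlongrightarrow> g p) (at p within S)"
      by (metis continuous_within tendsto_within_subset subset_UNIV)
    moreover have "eventually (\<lambda>x. g x = f x) (at p within S)"
      unfolding eventually_at_topological using U(1,2) eq by blast
    ultimately show ?thesis using eq[of p] p U(2) by (simp add: tendsto_cong)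
  qed
  then show ?thesis by (simp add: continuous_on_def)
qed

text \<open>The values of \<open>h\<close> lie in \<open>S\<close>, where a local ambient extension
  \<open>g\<close> agrees with \<open>f\<close>. On the open set of points that \<open>h\<close>
  sends into the domain of \<open>g\<close>, the composite is therefore \<open>g\<close> after
  \<open>h\<close>.\<close>

lemma smooth_on_subset_compose:
  assumes "smooth_on_subset S f" "open T" "smooth_on T h" "h ` T \<subseteq> S"
  shows "smooth_on T (\<lambda>x. f (h x))"
proof (rule smooth_on_local)
  fix p assume p: "p \<in> T"
  obtain U g where U: "open U" "h p \<in> U" "smooth_on U g" "\<And>x. x \<in> S \<inter> U \<Longrightarrow> g x = f x"
    using assms p unfolding smooth_on_subset_def by (metis image_subset_iff)
  define O' where "O' = T \<inter> h -` U"
  have O: "open O'" unfolding O'_def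
    using continuous_open_preimage[OF smooth_on_imp_continuous_on] assms U by blast
  have "smooth_on O' (\<lambda>x. g (h x))"
    by (rule smooth_on_compose[OF O U(1) _ _ U(3)])
       (auto simp: O'_def intro: smooth_on_subset[OF assms(3)])
  moreover have "g (h x) = f (h x)" if "x \<in> O'" for x
    using that U(4) assms(4) by (auto simp: O'_def)
  ultimately have "smooth_on O' (\<lambda>x. f (h x))"
    using smooth_on_cong[OF O] by metis
  then show "\<exists>U. open U \<and> p \<in> U \<and> smooth_on U (\<lambda>x. f (h x))"
    using O p U(2) by (auto simp: O'_def)
qed

section \<open>Slice charts\<close>

lemma smooth_submanifold_based_segments:
  fixes i0 :: "'n::finite"
  shows "smooth_submanifold CARD('n) (based_segments i0)"
  unfolding smooth_submanifold_def
proof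
  fix p assume p: "p \<in> based_segments i0"
  have M: "z \<in> based_segments i0 \<longleftrightarrow>
      (\<exists>a x. a \<noteq> 0 \<and> x \<noteq> (0 :: real ^ 'n) \<and> x $ i0 = 0 \<and> z = (\<chi> i. a * complex_of_real (x $ i)))" for z
    unfolding based_segments_eq by simp
  obtain j where j: "p $ j \<noteq> 0" "j \<noteq> i0"
    using p unfolding M vec_eq_iff by (metis mult_eq_0_iff of_real_eq_0_iff vec_lambda_beta zero_index)
  define U where "U = {z :: complex ^ 'n. z $ j \<noteq> 0}"
  define \<phi> where "\<phi> = (\<lambda>z :: complex ^ 'n. \<chi> k. if k = j then z $ j else z $ k / z $ j)"
  define \<psi> where "\<psi> = (\<lambda>w :: complex ^ 'n. \<chi> k. if k = j then w $ j else w $ k * w $ j)"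
  \<comment> \<open>The range of \<open>T\<close> is the linear slice: coordinate \<open>i0\<close>
    vanishes, coordinate \<open>j\<close> is any complex number, all others are real. This has 2 +
    (n - 2) = n real dimensions. The slot \<open>x $ i0\<close> is free, and so it stores the
    imaginary part of coordinate \<open>j\<close>.\<close>
  define T where "T = (\<lambda>x :: real ^ 'n. \<chi> k. if k = i0 then 0
    else if k = j then Complex (x $ j) (x $ i0) else complex_of_real (x $ k))"
  have "open U" unfolding U_def
    by (intro open_Collect_neq continuous_intros)
  have nth: "smooth_on U (\<lambda>z. z $ k)" for k
    by (rule smooth_on_linear[OF bounded_linear_vec_nth \<open>open U\<close>])
  have "smooth_on U \<phi>" unfolding \<phi>_def
  proof (rule smooth_on_vec_lambda[OF \<open>open U\<close>])
    show "smooth_on U (\<lambda>z. if k = j then z $ j else z $ k / z $ j)" for k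
      by (cases "k = j") (auto intro!: nth smooth_on_divide \<open>open U\<close> simp: U_def[symmetric], simp add: U_def)
  qed
  have "smooth_on U \<psi>" unfolding \<psi>_def
  proof (rule smooth_on_vec_lambda[OF \<open>open U\<close>])
    show "smooth_on U (\<lambda>z. if k = j then z $ j else z $ k * z $ j)" for k
      by (cases "k = j") (auto intro!: nth smooth_on_mult \<open>open U\<close>)
  qed
  \<comment> \<open>Both maps keep coordinate \<open>j\<close>, so \<open>U\<close> is the domain
    and the image of each.\<close>
  have \<phi>\<psi>: "\<phi> (\<psi> w) = w" "\<psi> w \<in> U" and \<psi>\<phi>: "\<psi> (\<phi> w) = w" "\<phi> w \<in> U" if "w \<in> U" for w
    using that by (auto simp: \<phi>_def \<psi>_def U_def vec_eq_iff)
  have bij: "bij_betw \<phi> U U" by (rule bij_betw_byWitness[where f' = \<psi>]) (use \<phi>\<psi> \<psi>\<phi> in auto)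
  have "inv_into U \<phi> w = \<psi> w" if "w \<in> U" for w
    using bij \<phi>\<psi>[OF that] by (metis bij_betw_imp_inj_on inv_into_f_eq)
  then have "smooth_on U (inv_into U \<phi>)"
    using \<open>smooth_on U \<psi>\<close> smooth_on_cong[OF \<open>open U\<close>] by metis
  then have diffeo: "diffeo_betw U U \<phi>"
    using bij \<open>open U\<close> \<open>smooth_on U \<phi>\<close> by (simp add: diffeo_betw_def)
  have "linear T"
    by (rule linearI) (auto simp: T_def vec_eq_iff complex_eq_iff)
  moreover have "inj T"
  proof (rule injI)
    fix x y assume "T x = T y"
    then have "T x $ k = T y $ k" for k by simp
    then have "x $ k = y $ k" for k
      using j(2) unfolding T_def by (cases "k = i0"; cases "k = j") (force split: if_splits)+
    then show "x = y" by (simp add: vec_eq_iff)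
  qed
  ultimately have L: "subspace (range T)" "dim (range T) = CARD('n)"
    by (auto simp: linear_subspace_image dim_image_eq)
  have "\<phi> ` (U \<inter> based_segments i0) = U \<inter> range T"
  proof (intro equalityI subsetI)
    fix w assume "w \<in> \<phi> ` (U \<inter> based_segments i0)"
    then obtain z where z: "w = \<phi> z" "z \<in> U" "z \<in> based_segments i0" by blast
    then obtain a x where a: "a \<noteq> 0" "x $ i0 = 0" "z = (\<chi> i. a * complex_of_real (x $ i))"
      unfolding M by blast
    \<comment> \<open>The common complex factor \<open>a\<close> cancels in quotients of
      coordinates; this is why the slice chart takes real values off position
      \<open>j\<close>.\<close>
    have quot: "z $ k / z $ j = complex_of_real (x $ k / x $ j)" for k
      using a(1) by (simp add: a(3))
    have "z $ i0 = 0" using a(2,3) by simp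
    have "w = T (\<chi> k. if k = i0 then Im (z $ j) else if k = j then Re (z $ j) else x $ k / x $ j)"
      unfolding vec_eq_iff z(1)
    proof
      fix k
      show "\<phi> z $ k =
          T (\<chi> k. if k = i0 then Im (z $ j) else if k = j then Re (z $ j) else x $ k / x $ j) $ k"
        using j(2) \<open>z $ i0 = 0\<close> quot[of k]
        by (cases "k = i0"; cases "k = j") (simp_all add: \<phi>_def T_def)
    qed
    then have "w \<in> range T" by (rule range_eqI)
    moreover have "w \<in> U" using \<psi>\<phi>(2)[OF z(2)] z(1) by simp
    ultimately show "w \<in> U \<inter> range T" by (rule IntI[rotated])
  next
    fix w assume "w \<in> U \<inter> range T"
    then obtain x where x: "w \<in> U" "w = T x" by blast
    have "\<psi> w \<in> based_segments i0" unfolding M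
    proof (intro exI conjI)
      \<comment> \<open>Here \<open>w $ j\<close> is taken as the common complex factor. The
        accompanying real vector has entry 1 at \<open>j\<close>, hence is nonzero.\<close>
      let ?y = "\<chi> k. if k = j then 1 else if k = i0 then 0 else x $ k"
      show "w $ j \<noteq> 0" using x by (simp add: U_def)
      show "?y \<noteq> 0" by (metis (mono_tags, lifting) vec_lambda_beta zero_index zero_neq_one)
      show "?y $ i0 = 0" using j(2) by simp
      show "\<psi> w = (\<chi> i. w $ j * complex_of_real (?y $ i))"
        using j(2) by (simp add: vec_eq_iff \<psi>_def x(2) T_def)
    qed
    then show "w \<in> \<phi> ` (U \<inter> based_segments i0)"
      by (intro image_eqI[of _ _ "\<psi> w"] IntI) (simp_all add: \<phi>\<psi>[OF x(1)])
  qed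
  moreover have "p \<in> U" using j(1) by (simp add: U_def)
  ultimately show "\<exists>U V (\<phi> :: complex ^ 'n \<Rightarrow> complex ^ 'n) L. p \<in> U \<and> diffeo_betw U V \<phi> \<and>
      subspace L \<and> dim L = CARD('n) \<and> \<phi> ` (U \<inter> based_segments i0) = V \<inter> L"
    using diffeo L by (intro exI[of _ U] exI[of _ \<phi>] exI[of _ "range T"] conjI)
qed

section \<open>The parametrization of based segments\<close>

lemma cis_of_int_pi: "cis (of_int k * pi) = complex_of_real ((-1) powi k)"
  by (cases "even k") (auto simp: complex_eq_iff cos_npi_int sin_npi_int mult.commute[of _ pi])

text \<open>The index types \<open>'m\<close> and \<open>'n\<close> are related only by cardinality.
  The bijection \<open>e\<close> from \<open>'m\<close> to the indices other than \<open>i0\<close>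
  identifies \<open>real ^ 'm\<close> with the real vectors that vanish at
  \<open>i0\<close>.\<close>

locale coordinate_complement =
  fixes e :: "'m::finite \<Rightarrow> 'n::finite" and i0 :: 'n
  assumes inj_e: "inj e" and range_e: "range e = - {i0}"
begin

definition seg_param :: "(real ^ 'm) \<times> real \<Rightarrow> complex ^ 'n" where
  "seg_param p = (\<chi> i. if i = i0 then 0 else cis (snd p) * complex_of_real (fst p $ inv e i))"

lemma e_neq: "e k \<noteq> i0"
  using range_e by auto

lemma seg_param_nth [simp]:
  "seg_param p $ i0 = 0"
  "seg_param p $ e k = cis (snd p) * complex_of_real (fst p $ k)"
  using inj_e e_neq by (simp_all add: seg_param_def)

lemma vec_eq_iff_complement: "z = w \<longleftrightarrow> z $ i0 = w $ i0 \<and> (\<forall>k. z $ e k = w $ e k)"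
proof
  assume *: "z $ i0 = w $ i0 \<and> (\<forall>k. z $ e k = w $ e k)"
  show "z = w" unfolding vec_eq_iff
  proof
    fix i show "z $ i = w $ i" using * range_e by (cases "i = i0") (simp, metis ComplI rangeE singletonD)
  qed
qed simp

lemma torus_cover_nth: "p \<in> torus_cover \<longleftrightarrow> (\<exists>k. fst p $ k \<noteq> 0)"
  by (cases p) (auto simp: torus_cover_def vec_eq_iff)

lemma seg_param_image: "seg_param ` torus_cover = based_segments i0"
  unfolding based_segments_eq
proof (intro equalityI subsetI)
  fix z assume "z \<in> seg_param ` torus_cover"
  then obtain p k where p: "z = seg_param p" "fst p $ k \<noteq> 0" by (auto simp: torus_cover_nth)
  define x where "x = (\<chi> i. if i = i0 then 0 else fst p $ inv e i)"
  have "z = (\<chi> i. cis (snd p) * complex_of_real (x $ i))"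
    by (simp add: p(1) seg_param_def x_def vec_eq_iff)
  moreover have "x $ e k \<noteq> 0" using p(2) inj_e e_neq by (simp add: x_def)
  then have "x \<noteq> 0" by auto
  moreover have "x $ i0 = 0" by (simp add: x_def)
  ultimately show "z \<in> {z. \<exists>a x. a \<noteq> 0 \<and> x \<noteq> (0 :: real ^ 'n) \<and> x $ i0 = 0 \<and>
      z = (\<chi> i. a * complex_of_real (x $ i))}"
    using cis_neq_zero by blast
next
  fix z assume "z \<in> {z. \<exists>a x. a \<noteq> 0 \<and> x \<noteq> (0 :: real ^ 'n) \<and> x $ i0 = 0 \<and>
      z = (\<chi> i. a * complex_of_real (x $ i))}"
  then obtain a and x :: "real ^ 'n" where a: "a \<noteq> 0" "x \<noteq> 0" "x $ i0 = 0"
    and z: "z = (\<chi> i. a * complex_of_real (x $ i))" by blast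
  obtain k where k: "x $ e k \<noteq> 0" using a(2,3) by (auto simp: vec_eq_iff_complement)
  \<comment> \<open>Polar form of the factor \<open>a\<close>: the modulus is absorbed into the real
    vector, the argument becomes the angle.\<close>
  define p where "p = ((\<chi> k. cmod a * x $ e k), Arg a)"
  have "complex_of_real (cmod a) * cis (Arg a) = a" by (metis rcis_cmod_Arg rcis_def)
  then have "z = seg_param p"
    by (simp add: vec_eq_iff_complement z p_def a(3) mult.assoc[symmetric] mult.commute[of "cis _"])
  moreover have "p \<in> torus_cover" using a(1) k by (auto simp: torus_cover_nth p_def)
  ultimately show "z \<in> seg_param ` torus_cover" by blast
qed

text \<open>Shifting the angle by \<open>k * pi\<close> multiplies by \<open>(-1) powi k\<close>,
  and the deck map multiplies the vector by the same sign; the two cancel.\<close>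

lemma seg_param_torus_deck: "seg_param (torus_deck k p) = seg_param p"
proof -
  have "complex_of_real ((-1) powi k) * complex_of_real ((-1) powi k) = 1"
    by (simp flip: of_real_mult power_int_mult_distrib)
  then have "cis (t + of_int k * pi) * complex_of_real ((-1) powi k * r) = cis t * complex_of_real r" for t r
    by (simp only: cis_mult[symmetric] cis_of_int_pi of_real_mult mult.assoc)
       (simp only: mult.assoc[symmetric] mult_1_left)
  then show ?thesis by (cases p) (simp add: vec_eq_iff_complement torus_deck_def)
qed

text \<open>At a nonzero coordinate, \<open>cis (s - t)\<close> carries one real number to another,
  nonzero one, so \<open>s - t\<close> is a multiple of \<open>pi\<close>. A deck transformation
  then makes the angles equal, and the common factor \<open>cis\<close> can be cancelled in every
  coordinate.\<close>

lemma seg_param_eq_iff: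
  assumes "p \<in> torus_cover"
  shows "seg_param p = seg_param q \<longleftrightarrow> (\<exists>k. q = torus_deck k p)"
proof
  assume eq: "seg_param p = seg_param q"
  obtain X t where p: "p = (X, t)" by force
  obtain Y s where q: "q = (Y, s)" by force
  obtain k where k: "X $ k \<noteq> 0" using assms by (auto simp: torus_cover_nth p)
  have "cis s * complex_of_real (Y $ k) = cis t * complex_of_real (X $ k)"
    using arg_cong[OF eq, of "\<lambda>z. z $ e k"] by (simp add: p q)
  then have "cis (- t) * (cis s * complex_of_real (Y $ k)) = complex_of_real (X $ k)"
    by (simp add: mult.assoc[symmetric] cis_mult)
  then have *: "cis (s - t) * complex_of_real (Y $ k) = complex_of_real (X $ k)"
    by (simp add: mult.assoc[symmetric] cis_mult)
  then have "Y $ k \<noteq> 0" using k by auto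
  moreover have "sin (s - t) * Y $ k = 0" using arg_cong[OF *, of Im] by simp
  ultimately have "sin (s - t) = 0" by simp
  then obtain i where "s - t = of_int i * pi" by (auto simp: sin_zero_iff_int2)
  then have s: "s = t + of_int i * pi" by simp
  have "seg_param (torus_deck i p) = seg_param q" by (simp add: seg_param_torus_deck eq)
  moreover have snd: "snd (torus_deck i p) = snd q" by (simp add: p q torus_deck_def s)
  ultimately have "cis (snd q) * complex_of_real (fst (torus_deck i p) $ l) =
      cis (snd q) * complex_of_real (fst q $ l)" for l by (metis seg_param_nth(2))
  then have "fst (torus_deck i p) $ l = fst q $ l" for l
    by (simp only: mult_cancel_left cis_neq_zero of_real_eq_iff simp_thms)
  then have "q = torus_deck i p" by (simp add: prod_eq_iff vec_eq_iff snd)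
  then show "\<exists>k. q = torus_deck k p" ..
qed (auto simp: seg_param_torus_deck)

text \<open>Both equations say that the points lie in one deck orbit. Through this equivalence the
  glued classes are replaced by points of \<open>complex ^ 'n\<close>.\<close>

lemma torus_proj_eq_iff_seg_param:
  assumes "p \<in> torus_cover" "q \<in> torus_cover"
  shows "torus_proj p = torus_proj q \<longleftrightarrow> seg_param p = seg_param q"
  using assms torus_proj_eq_iff seg_param_eq_iff by metis

lemma smooth_on_seg_param:
  assumes "open S"
  shows "smooth_on S seg_param"
proof -
  have "smooth_on S (\<lambda>p. if i = i0 then 0 else cis (snd p) * complex_of_real (fst p $ inv e i))" for i
  proof (cases "i = i0")
    case False
    have "bounded_linear (\<lambda>p :: (real ^ 'm) \<times> real. complex_of_real (fst p $ inv e i))"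
      by (intro bounded_linear_compose[OF bounded_linear_of_real]
          bounded_linear_compose[OF bounded_linear_vec_nth] bounded_linear_fst)
    then have "smooth_on S (\<lambda>p :: (real ^ 'm) \<times> real. cis (snd p) * complex_of_real (fst p $ inv e i))"
      by (intro smooth_on_mult smooth_on_cis smooth_on_linear bounded_linear_snd assms)
    then show ?thesis using False by simp
  qed (simp add: smooth_on_const)
  then show ?thesis
    unfolding seg_param_def[abs_def] by (rule smooth_on_vec_lambda[OF assms])
qed

text \<open>The exact equality for the image of \<open>Q\<close> says more than local injectivity:
  every based segment in the ambient open set \<open>N\<close> comes from \<open>Q\<close>. Openness
  of \<open>seg_param\<close> onto its image and the charts on both sides are derived from
  it.\<close>

lemma seg_param_local_inverse:
  assumes q0: "q0 \<in> torus_cover"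
  obtains Q N G where "open Q" "q0 \<in> Q" "Q \<subseteq> torus_cover" "open N" "smooth_on N G"
    "seg_param ` Q = based_segments i0 \<inter> N" "\<And>q. q \<in> Q \<Longrightarrow> G (seg_param q) = q"
proof -
  obtain X0 t0 where q0_eq: "q0 = (X0, t0)" by force
  obtain j where j: "X0 $ j \<noteq> 0" using q0 by (auto simp: torus_cover_nth q0_eq)
  \<comment> \<open>Normalised so that the image of \<open>q0\<close> has \<open>w\<close>-value 1,
    inside the domain of the principal branch of \<open>Ln\<close>. The imaginary part of
    \<open>Ln\<close> then measures the angle relative to \<open>t0\<close>.\<close>
  define w where "w = (\<lambda>z :: complex ^ 'n. z $ e j * (cis (- t0) / complex_of_real (X0 $ j)))"
  define N where "N = w -` (- \<real>\<^sub>\<le>\<^sub>0)"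
  define \<theta> where "\<theta> = (\<lambda>z. t0 + Im (Ln (w z)))"
  define G where "G = (\<lambda>z. ((\<chi> k. Re (cis (- \<theta> z) * z $ e k)) :: real ^ 'm, \<theta> z))"
  \<comment> \<open>The angles fill an interval of length \<open>2 * pi\<close>, twice the shift of
    the generating deck transformation. Odd shifts are excluded by the sign condition on coordinate
    \<open>j\<close>, nonzero even ones by the length of the open interval.\<close>
  define Q where "Q = {p :: (real ^ 'm) \<times> real. 0 < fst p $ j / X0 $ j \<and> \<bar>snd p - t0\<bar> < pi}"
  have "open Q" unfolding Q_def
    by (intro open_Collect_conj open_Collect_less continuous_intros) (use j in auto)
  moreover have "q0 \<in> Q" using j by (simp add: Q_def q0_eq)
  moreover have "Q \<subseteq> torus_cover" 
  proof
    fix p assume "p \<in> Q"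
    then have "fst p $ j \<noteq> 0" by (auto simp: Q_def)
    then show "p \<in> torus_cover" unfolding torus_cover_nth ..
  qed
  moreover have "continuous_on UNIV w" unfolding w_def by (intro continuous_intros) (use j in auto)
  then have "open N" unfolding N_def by (rule open_vimage[rotated]) (simp add: open_Compl)
  moreover have "smooth_on N G"
  proof -
    have nth: "smooth_on N (\<lambda>z. z $ k)" for k
      by (rule smooth_on_linear[OF bounded_linear_vec_nth \<open>open N\<close>])
    have w: "smooth_on N w" unfolding w_def
      by (intro smooth_on_mult smooth_on_const nth \<open>open N\<close>)
    have \<theta>: "smooth_on N \<theta>" unfolding \<theta>_def
      by (intro smooth_on_add smooth_on_linear_compose[OF bounded_linear_Im] smooth_on_Ln w
          smooth_on_const \<open>open N\<close>)
         (simp add: N_def)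
    then show ?thesis unfolding G_def
      by (intro smooth_on_Pair smooth_on_vec_lambda smooth_on_linear_compose[OF bounded_linear_Re]
          smooth_on_mult smooth_on_cis nth \<open>open N\<close>
          smooth_on_linear_compose[OF bounded_linear_minus[OF bounded_linear_ident]])
  qed
  moreover have GF: "G (seg_param p) = p" and FN: "seg_param p \<in> N" if p: "p \<in> Q" for p
  proof -
    obtain X t where p_eq: "p = (X, t)" by force
    have r: "0 < X $ j / X0 $ j" and t: "\<bar>t - t0\<bar> < pi" using p by (auto simp: Q_def p_eq)
    have "w (seg_param p) = complex_of_real (X $ j / X0 $ j) * (cis t * cis (- t0))"
      by (simp add: w_def p_eq)
    then have "w (seg_param p) = rcis (X $ j / X0 $ j) (t - t0)"
      by (simp add: cis_mult rcis_def)
    moreover have "Arg (rcis (X $ j / X0 $ j) (t - t0)) = t - t0"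
      by (rule Arg_rcis) (use r t in auto)
    ultimately have Arg: "Arg (w (seg_param p)) = t - t0" and nz: "w (seg_param p) \<noteq> 0"
      using r by (auto simp: rcis_def)
    then show "seg_param p \<in> N" using t Arg_eq_pi[of "w (seg_param p)"]
      by (auto simp: N_def complex_nonpos_Reals_iff complex_eq_iff)
    have \<theta>: "\<theta> (seg_param p) = t" using Arg nz by (simp add: \<theta>_def Arg_eq_Im_Ln)
    have "cis (- t) * (cis t * complex_of_real r) = complex_of_real r" for r
      by (simp add: mult.assoc[symmetric] cis_mult)
    then have "Re (cis (- \<theta> (seg_param p)) * seg_param p $ e k) = X $ k" for k
      unfolding \<theta> by (simp only: seg_param_nth p_eq fst_conv snd_conv Re_complex_of_real)
    then have "G (seg_param p) = (X, \<theta> (seg_param p))" by (simp only: G_def vec_lambda_eta)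
    then show "G (seg_param p) = p" using \<theta> p_eq by simp
  qed
  moreover have "seg_param ` Q = based_segments i0 \<inter> N"
  proof (intro equalityI subsetI)
    fix z assume "z \<in> seg_param ` Q"
    then show "z \<in> based_segments i0 \<inter> N"
      using FN \<open>Q \<subseteq> torus_cover\<close> unfolding seg_param_image[symmetric] by blast
  next
    fix z assume z: "z \<in> based_segments i0 \<inter> N"
    \<comment> \<open>\<open>(Y, s)\<close> is an arbitrary preimage and may lie outside
      \<open>Q\<close>; the aim is that \<open>G z\<close> is a preimage inside
      \<open>Q\<close>.\<close>
    then obtain Y s where zF: "z = seg_param (Y, s)" unfolding seg_param_image[symmetric] by auto
    have wz: "w z \<noteq> 0" using z by (auto simp: N_def)
    then have Yj: "Y $ j \<noteq> 0" by (auto simp: w_def zF)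
    have Arg: "Im (Ln (w z)) = Arg (w z)" using wz by (simp add: Arg_eq_Im_Ln)
    have "Arg (w z) \<noteq> pi"
      using z Arg_eq_pi[of "w z"] by (auto simp: N_def complex_nonpos_Reals_iff)
    then have "\<bar>Arg (w z)\<bar> < pi" using Arg_bounded[of "w z"] by auto
    then have \<theta>_bd: "\<bar>\<theta> z - t0\<bar> < pi" by (simp add: \<theta>_def Arg)
    have polar: "complex_of_real (cmod (w z)) * cis (\<theta> z - t0) = w z"
      unfolding \<theta>_def Arg by (metis add_diff_cancel_left' rcis_cmod_Arg rcis_def)
    have "complex_of_real (cmod (w z)) =
        complex_of_real (cmod (w z)) * (cis (\<theta> z - t0) * cis (t0 - \<theta> z))" by (simp add: cis_mult)
    also have "\<dots> = w z * cis (t0 - \<theta> z)" by (simp only: polar mult.assoc[symmetric])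
    also have "\<dots> = complex_of_real (Y $ j / X0 $ j) * (cis s * cis (- t0) * cis (t0 - \<theta> z))"
    proof -
      have "w z = complex_of_real (Y $ j / X0 $ j) * (cis s * cis (- t0))"
        by (simp add: w_def zF)
      then show ?thesis by (simp only: mult.assoc)
    qed
    also have "\<dots> = cis (s - \<theta> z) * complex_of_real (Y $ j / X0 $ j)"
      by (simp add: cis_mult mult.commute)
    finally have ws: "complex_of_real (cmod (w z)) = cis (s - \<theta> z) * complex_of_real (Y $ j / X0 $ j)" .
    \<comment> \<open>All coordinates of \<open>z\<close> are real multiples of the
      \<open>j\<close>-th, and rotation by \<open>- \<theta> z\<close> turns that one into
      \<open>cmod (w z) * X0 $ j\<close>. Hence the real parts taken in \<open>G\<close> lose
      nothing.\<close>
    have real: "cis (- \<theta> z) * z $ e k = complex_of_real (cmod (w z) * X0 $ j / Y $ j * Y $ k)" for k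
    proof -
      have "cis (- \<theta> z) * z $ e k = cis (s - \<theta> z) * complex_of_real (Y $ k)"
        by (simp add: zF mult.assoc[symmetric] cis_mult)
      also have "\<dots> = complex_of_real (cmod (w z)) * complex_of_real (X0 $ j / Y $ j * Y $ k)"
        unfolding ws using Yj j by simp
      finally show ?thesis by simp
    qed
    have G_fst: "fst (G z) $ k = cmod (w z) * X0 $ j / Y $ j * Y $ k" for k
      by (simp only: G_def fst_conv vec_lambda_beta real Re_complex_of_real)
    have G_snd: "snd (G z) = \<theta> z" by (simp add: G_def)
    have "seg_param (G z) = z"
      unfolding vec_eq_iff_complement
    proof (intro conjI allI)
      fix k
      have "seg_param (G z) $ e k = cis (\<theta> z) * (cis (- \<theta> z) * z $ e k)"
        by (simp only: seg_param_nth G_fst G_snd real)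
      then show "seg_param (G z) $ e k = z $ e k" by (simp add: mult.assoc[symmetric] cis_mult)
    qed (simp add: zF)
    \<comment> \<open>The quotient tested in \<open>Q\<close> equals \<open>cmod (w z)\<close>,
      which is positive because \<open>w z\<close> is nonzero.\<close>
    moreover have "G z \<in> Q"
      using \<theta>_bd wz j Yj by (simp add: Q_def G_fst G_snd)
    ultimately show "z \<in> seg_param ` Q" by (metis image_eqI)
  qed
  ultimately show ?thesis using that by blast
qed

end

section \<open>Charts and topology\<close>

lemma smooth_atlasI:
  assumes "\<And>x. x \<in> topspace X \<Longrightarrow> \<exists>U \<phi>. (U, \<phi>) \<in> A \<and> x \<in> U"
    and "\<And>U \<phi>. (U, \<phi>) \<in> A \<Longrightarrow> openin X U"
    and "\<And>U \<phi>. (U, \<phi>) \<in> A \<Longrightarrow> open (\<phi> ` U)"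
    and "\<And>U \<phi>. (U, \<phi>) \<in> A \<Longrightarrow> homeomorphic_map (subtopology X U) (top_of_set (\<phi> ` U)) \<phi>"
    and "\<And>U \<phi> W \<psi>. (U, \<phi>) \<in> A \<Longrightarrow> (W, \<psi>) \<in> A \<Longrightarrow>
      smooth_on (\<phi> ` (U \<inter> W)) (\<lambda>x. \<psi> (inv_into U \<phi> x))"
  shows "smooth_atlas X A"
proof -
  have "(\<Union>(U, \<phi>)\<in>A. U) = topspace X"
  proof (intro equalityI subsetI)
    fix x assume "x \<in> (\<Union>(U, \<phi>)\<in>A. U)"
    then obtain U \<phi> where "(U, \<phi>) \<in> A" "x \<in> U" by auto
    then show "x \<in> topspace X" using assms(2) openin_subset by blast
  next
    fix x assume "x \<in> topspace X"
    then obtain U \<phi> where "(U, \<phi>) \<in> A" "x \<in> U" using assms(1) by blast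
    then show "x \<in> (\<Union>(U, \<phi>)\<in>A. U)" by auto
  qed
  then show ?thesis
    using assms(2-5) by (simp add: smooth_atlas_def comp_def Ball_def split_paired_All)
qed

lemma smooth_mapI:
  assumes "continuous_map X Y f"
    and "\<And>U \<phi> W \<psi>. (U, \<phi>) \<in> A \<Longrightarrow> (W, \<psi>) \<in> B \<Longrightarrow>
      smooth_on (\<phi> ` (U \<inter> f -` W)) (\<lambda>x. \<psi> (f (inv_into U \<phi> x)))"
  shows "smooth_map X A Y B f"
  using assms by (simp add: smooth_map_def comp_def Ball_def split_paired_All)

section \<open>Charts of embedded submanifolds\<close>

lemma submanifold_atlasD:
  assumes "(U, \<phi>) \<in> submanifold_atlas M"
  shows "openin (top_of_set M) U" "U \<subseteq> M" "open (\<phi> ` U)" "inj_on \<phi> U"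
    "smooth_on_subset U \<phi>" "smooth_on (\<phi> ` U) (inv_into U \<phi>)"
  using assms openin_imp_subset unfolding submanifold_atlas_def by auto

lemma submanifold_chart_homeomorphic_map:
  assumes "(U, \<phi>) \<in> submanifold_atlas M"
  shows "homeomorphic_map (subtopology (top_of_set M) U) (top_of_set (\<phi> ` U)) \<phi>"
proof -
  note U = submanifold_atlasD[OF assms]
  have "homeomorphic_maps (top_of_set U) (top_of_set (\<phi> ` U)) \<phi> (inv_into U \<phi>)"
    unfolding homeomorphic_maps_def
    using U(4) smooth_on_subset_imp_continuous_on[OF U(5)] smooth_on_imp_continuous_on[OF U(6)]
    by (auto simp: inv_into_into f_inv_into_f)
  then show ?thesis
    using U(2) by (auto simp: subtopology_subtopology Int_absorb1 homeomorphic_map_maps)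
qed

text \<open>The image is a preimage under the continuous inverse of the chart, hence relatively open
  in the open set of chart values.\<close>

lemma open_submanifold_chart_image:
  assumes "(U, \<phi>) \<in> submanifold_atlas M" "openin (top_of_set M) W"
  shows "open (\<phi> ` (U \<inter> W))"
proof -
  note U = submanifold_atlasD[OF assms(1)]
  have "\<phi> ` (U \<inter> W) = \<phi> ` U \<inter> inv_into U \<phi> -` W"
    using U(4) by (auto simp: inv_into_f_f)
  moreover have "openin (top_of_set (\<phi> ` U)) (\<phi> ` U \<inter> inv_into U \<phi> -` W)"
    by (rule continuous_openin_preimage[OF smooth_on_imp_continuous_on[OF U(6)] _ assms(2)])
       (use U(2) in \<open>auto simp: U(4)\<close>)
  ultimately show ?thesis using U(3) openin_open_trans by metis
qed

text \<open>Used with \<open>f\<close> another submanifold chart, for transition maps, and with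
  \<open>f\<close> an inverse of \<open>seg_param\<close>, for the map to the torus.\<close>

lemma smooth_on_submanifold_chart:
  assumes "(U, \<phi>) \<in> submanifold_atlas M" "openin (top_of_set M) W"
    and f: "smooth_on_subset W f"
  shows "smooth_on (\<phi> ` (U \<inter> W)) (\<lambda>x. f (inv_into U \<phi> x))"
proof (rule smooth_on_subset_compose[OF f open_submanifold_chart_image[OF assms(1,2)]])
  note U = submanifold_atlasD[OF assms(1)]
  show "smooth_on (\<phi> ` (U \<inter> W)) (inv_into U \<phi>)"
    by (rule smooth_on_subset[OF U(6)]) blast
  show "inv_into U \<phi> ` \<phi> ` (U \<inter> W) \<subseteq> W" using U(4) by auto
qed

lemma second_countable_euclidean:
  "second_countable (euclidean :: 'a::second_countable_topology topology)"
proof -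
  obtain B :: "'a set set" where B: "countable B" "topological_basis B"
    using ex_countable_basis by blast
  have "\<exists>V\<in>B. x \<in> V \<and> V \<subseteq> U" if U: "open U \<and> x \<in> U" for U x
  proof -
    obtain V where "V \<in> B" "x \<in> V" "V \<subseteq> U"
      using topological_basisE[OF B(2) conjunct1[OF U] conjunct2[OF U]] .
    then show ?thesis by blast
  qed
  then show ?thesis
    unfolding second_countable_def open_openin[symmetric]
    using B(1) topological_basis_open[OF B(2)] by (intro exI[of _ B]) simp
qed

text \<open>Each chart is by definition a diffeomorphism onto an open set, which makes any two
  compatible. What remains to be supplied is that the charts cover \<open>M\<close>.\<close>

lemma smooth_manifold_submanifold_atlas:
  fixes M :: "'a::euclidean_space set"
  assumes "\<And>p. p \<in> M \<Longrightarrow> \<exists>U \<phi>. (U, \<phi> :: 'a \<Rightarrow> 'e::euclidean_space) \<in> submanifold_atlas M \<and> p \<in> U"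
  shows "smooth_manifold (top_of_set M) (submanifold_atlas M :: ('a, 'e) chart set)"
proof -
  have "Hausdorff_space (top_of_set M)" by (simp add: Hausdorff_space_subtopology)
  moreover have "second_countable (top_of_set M)"
    by (intro second_countable_subtopology second_countable_euclidean)
  moreover have "smooth_atlas (top_of_set M) (submanifold_atlas M :: ('a, 'e) chart set)"
  proof (rule smooth_atlasI)
    show "\<exists>U \<phi>. (U, \<phi> :: 'a \<Rightarrow> 'e) \<in> submanifold_atlas M \<and> x \<in> U" if "x \<in> topspace (top_of_set M)" for x
      using assms that by simp
    show "smooth_on (\<phi> ` (U \<inter> W)) (\<lambda>x. \<psi> (inv_into U \<phi> x))"
      if "(U, \<phi> :: 'a \<Rightarrow> 'e) \<in> submanifold_atlas M" "(W, \<psi> :: 'a \<Rightarrow> 'e) \<in> submanifold_atlas M"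
      for U \<phi> W \<psi>
      by (rule smooth_on_submanifold_chart[OF that(1) submanifold_atlasD(1,5)[OF that(2)]])
  qed (rule submanifold_atlasD submanifold_chart_homeomorphic_map; assumption)+
  ultimately show ?thesis by (simp add: smooth_manifold_def)
qed

section \<open>Topology of the orbit projection\<close>

lemma open_torus_cover: "open torus_cover"
  unfolding torus_cover_def by (intro open_Times) (simp_all add: open_Diff)

lemma continuous_on_torus_deck: "continuous_on S (torus_deck k)"
  unfolding torus_deck_def case_prod_beta by (intro continuous_intros)

lemma torus_proj_torus_deck: "p \<in> torus_cover \<Longrightarrow> torus_proj (torus_deck k p) = torus_proj p"
  using torus_proj_eq_iff torus_deck_in_cover by metis

text \<open>Of the two glued ends only angle 0 is kept, so that the seam has to be examined from one
  end only.\<close>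

lemma torus_deck_half_open_strip:
  obtains k where "0 \<le> snd (torus_deck k p)" "snd (torus_deck k p) < pi"
proof -
  define k where "k = \<lfloor>snd p / pi\<rfloor>"
  have "of_int k \<le> snd p / pi" "snd p / pi < of_int k + 1" by (auto simp: k_def)
  then have "0 \<le> snd (torus_deck (- k) p)" "snd (torus_deck (- k) p) < pi"
    by (simp_all add: torus_deck_def case_prod_beta field_simps)
  then show ?thesis using that by blast
qed

text \<open>Open sets of the quotient are tested on their unions in the strip. Since
  \<open>W\<close> consists of whole classes, membership of a point in the union determines
  membership of its class.\<close>

lemma torus_proj_mem_iff:
  assumes "W \<subseteq> torus_strip // torus_glue" "p \<in> torus_strip"
  shows "torus_proj p \<in> W \<longleftrightarrow> p \<in> \<Union>W"
proof
  assume "torus_proj p \<in> W"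
  moreover have "p \<in> torus_proj p"
    unfolding torus_proj_strip[OF assms(2)] by (rule equiv_class_self[OF equiv_torus_glue assms(2)])
  ultimately show "p \<in> \<Union>W" by blast
next
  assume "p \<in> \<Union>W"
  then obtain c where c: "c \<in> W" "p \<in> c" by blast
  then have "c \<in> torus_strip // torus_glue" using assms(1) by blast
  then obtain q where q: "c = torus_glue `` {q}" by (rule quotientE)
  then have "(q, p) \<in> torus_glue" using c(2) by simp
  then have "c = torus_glue `` {p}"
    unfolding q by (rule equiv_class_eq[OF equiv_torus_glue])
  then show "torus_proj p \<in> W" using c(1) assms(2) by (simp add: torus_proj_strip)
qed

text \<open>This is continuity of the projection on the whole cover, whereas the topology refers to
  the strip alone. The preimage is invariant under deck transformations, which are continuous, so
  neighbourhoods are constructed for angles in \<open>[0, pi)\<close> and then moved.\<close>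

lemma open_torus_proj_vimage:
  assumes W: "openin mapping_torus (W :: ((real ^ 'm) \<times> real) set set)"
  shows "open {p \<in> torus_cover. torus_proj p \<in> W}" (is "open ?P")
proof -
  have sub: "W \<subseteq> torus_strip // torus_glue" and "openin (top_of_set torus_strip) (\<Union>W)"
    using W by (auto simp: openin_mapping_torus)
  then obtain A where "open A" and A: "\<Union>W = torus_strip \<inter> A" by (auto simp: openin_open)
  have P: "p \<in> ?P \<longleftrightarrow> p \<in> A" if "p \<in> torus_strip" for p
    using that torus_proj_mem_iff[OF sub that] A by (auto simp: torus_strip_def torus_cover_def)
  have deck: "torus_deck k p \<in> ?P \<longleftrightarrow> p \<in> ?P" if "p \<in> torus_cover" for k p
    using that by (simp add: torus_proj_torus_deck[OF that] torus_deck_in_cover[OF that])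
  have nbhd: "\<exists>B. open B \<and> p \<in> B \<and> B \<subseteq> ?P"
    if p: "p \<in> ?P" and range: "0 \<le> snd p" "snd p < pi" for p
  proof -
    have cover: "p \<in> torus_cover" and strip: "p \<in> torus_strip"
      using p range by (cases p; auto simp: torus_strip_def torus_cover_def)+
    show ?thesis
    proof (cases "snd p = 0")
      case False
      let ?B = "torus_cover \<inter> snd -` {0<..<pi} \<inter> A"
      have "open ?B" using \<open>open A\<close> open_torus_cover
        by (intro open_Int open_vimage_snd) auto
      moreover have "p \<in> ?B" using P[OF strip] p cover range False by auto
      moreover have "?B \<subseteq> ?P"
      proof
        fix q assume q: "q \<in> ?B"
        then have "q \<in> torus_strip" by (cases q) (auto simp: torus_strip_def torus_cover_def)
        then show "q \<in> ?P" using P q by blast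
      qed
      ultimately show ?thesis by blast
    next
      case True
      \<comment> \<open>A point on the seam: its upper half neighbourhood lies in the strip, the lower half after one
        deck transformation.\<close>
      let ?B = "torus_cover \<inter> snd -` {-pi<..<pi} \<inter> A \<inter> torus_deck 1 -` A"
      have "open ?B" using \<open>open A\<close> open_torus_cover
        by (intro open_Int open_vimage_snd open_vimage continuous_on_torus_deck) auto
      moreover have "torus_deck 1 p \<in> torus_strip"
        using True cover by (cases p) (auto simp: torus_deck_def torus_strip_def torus_cover_def)
      then have "torus_deck 1 p \<in> A" using P deck[OF cover] p by blast
      then have "p \<in> ?B" using P[OF strip] p cover True by auto
      moreover have "?B \<subseteq> ?P"
      proof
        fix q assume q: "q \<in> ?B"
        show "q \<in> ?P"
        proof (cases "0 \<le> snd q")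
          case True
          then have "q \<in> torus_strip" using q by (cases q) (auto simp: torus_strip_def torus_cover_def)
          then show ?thesis using P q by blast
        next
          case False
          then have "torus_deck 1 q \<in> torus_strip"
            using q by (cases q) (auto simp: torus_deck_def torus_strip_def torus_cover_def)
          then show ?thesis using P deck q by blast
        qed
      qed
      ultimately show ?thesis by blast
    qed
  qed
  show ?thesis
  proof (subst open_subopen, intro ballI)
    fix p assume p: "p \<in> ?P"
    then have cover: "p \<in> torus_cover" by blast
    obtain k where "0 \<le> snd (torus_deck k p)" "snd (torus_deck k p) < pi"
      using torus_deck_half_open_strip by blast
    then obtain B where B: "open B" "torus_deck k p \<in> B" "B \<subseteq> ?P"
      using nbhd[of "torus_deck k p"] deck[OF cover] p by blast
    have "open (torus_cover \<inter> torus_deck k -` B)"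
      using B(1) open_torus_cover by (intro open_Int open_vimage continuous_on_torus_deck) auto
    moreover have "torus_cover \<inter> torus_deck k -` B \<subseteq> ?P" using B(3) deck by blast
    ultimately show "\<exists>T. open T \<and> p \<in> T \<and> T \<subseteq> ?P" using B(2) cover by blast
  qed
qed

section \<open>The induced homeomorphism\<close>

context coordinate_complement
begin

text \<open>Each of the two maps passes through a chosen preimage in the cover; equality of the
  fibres makes the result independent of that choice.\<close>

definition seg_of_torus :: "((real ^ 'm) \<times> real) set \<Rightarrow> complex ^ 'n" where
  "seg_of_torus c = seg_param (inv_into torus_cover torus_proj c)"

definition torus_of_seg :: "complex ^ 'n \<Rightarrow> ((real ^ 'm) \<times> real) set" where
  "torus_of_seg z = torus_proj (inv_into torus_cover seg_param z)"

lemma seg_of_torus_proj: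
  assumes "p \<in> torus_cover"
  shows "seg_of_torus (torus_proj p) = seg_param p"
proof -
  have p: "torus_proj p \<in> torus_proj ` torus_cover" using assms by (rule imageI)
  show ?thesis
    unfolding seg_of_torus_def torus_proj_eq_iff_seg_param[OF inv_into_into[OF p] assms, symmetric]
    by (rule f_inv_into_f[OF p])
qed

lemma torus_of_seg_param:
  assumes "p \<in> torus_cover"
  shows "torus_of_seg (seg_param p) = torus_proj p"
proof -
  have p: "seg_param p \<in> seg_param ` torus_cover" using assms by (rule imageI)
  show ?thesis
    unfolding torus_of_seg_def torus_proj_eq_iff_seg_param[OF inv_into_into[OF p] assms]
    by (rule f_inv_into_f[OF p])
qed

lemma inj_on_torus_proj_iff:
  assumes "V \<subseteq> torus_cover"
  shows "inj_on torus_proj V \<longleftrightarrow> inj_on seg_param V"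
proof -
  have "torus_proj p = torus_proj q \<longleftrightarrow> seg_param p = seg_param q" if "p \<in> V" "q \<in> V" for p q
    using assms that by (intro torus_proj_eq_iff_seg_param) auto
  then show ?thesis unfolding inj_on_def by blast
qed

text \<open>Near a given point, the image of \<open>V\<close> is cut out of the based segments by
  the open condition that the local inverse \<open>G\<close> takes its value in
  \<open>V\<close>.\<close>

lemma openin_seg_param_image:
  assumes "open V" "V \<subseteq> torus_cover"
  shows "openin (top_of_set (based_segments i0)) (seg_param ` V)"
proof (subst openin_subopen, intro ballI)
  fix z assume "z \<in> seg_param ` V"
  then obtain p where p: "p \<in> V" "z = seg_param p" by blast
  obtain Q N G where Q: "open Q" "p \<in> Q" "Q \<subseteq> torus_cover" "open N" "smooth_on N G"
    "seg_param ` Q = based_segments i0 \<inter> N" "\<And>q. q \<in> Q \<Longrightarrow> G (seg_param q) = q"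
    using seg_param_local_inverse p assms(2) by blast
  have "seg_param ` (V \<inter> Q) = based_segments i0 \<inter> (N \<inter> G -` V)"
  proof (intro equalityI subsetI)
    fix x assume "x \<in> seg_param ` (V \<inter> Q)"
    then obtain q where q: "q \<in> V" "q \<in> Q" "x = seg_param q" by blast
    then have "x \<in> based_segments i0 \<inter> N" unfolding Q(6)[symmetric] by blast
    then show "x \<in> based_segments i0 \<inter> (N \<inter> G -` V)" using q by (simp add: Q(7))
  next
    fix x assume x: "x \<in> based_segments i0 \<inter> (N \<inter> G -` V)"
    then have "x \<in> seg_param ` Q" unfolding Q(6) by blast
    then obtain q where q: "q \<in> Q" "x = seg_param q" by blast
    then have "q \<in> V" using x by (simp add: Q(7))
    then show "x \<in> seg_param ` (V \<inter> Q)" using q by blast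
  qed
  moreover have "open (N \<inter> G -` V)"
    using continuous_open_preimage[OF smooth_on_imp_continuous_on[OF Q(5)] Q(4) assms(1)] .
  ultimately have "openin (top_of_set (based_segments i0)) (seg_param ` (V \<inter> Q))"
    by (auto simp: openin_open)
  then show "\<exists>T. openin (top_of_set (based_segments i0)) T \<and> z \<in> T \<and> T \<subseteq> seg_param ` V"
    using p Q(2) by blast
qed

text \<open>A local inverse \<open>G\<close> may select a preimage other than the one in
  \<open>V\<close>. After restriction to points with \<open>G\<close>-value in \<open>V\<close>,
  injectivity on \<open>V\<close> forces the two inverses to agree, and \<open>G\<close> is the
  required ambient extension.\<close>

lemma smooth_on_subset_inv_seg_param:
  assumes "open V" "V \<subseteq> torus_cover" "inj_on seg_param V"
  shows "smooth_on_subset (seg_param ` V) (inv_into V seg_param)"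
  unfolding smooth_on_subset_def
proof
  fix z assume "z \<in> seg_param ` V"
  then obtain p where p: "p \<in> V" "z = seg_param p" by blast
  obtain Q N G where Q: "open Q" "p \<in> Q" "Q \<subseteq> torus_cover" "open N" "smooth_on N G"
    "seg_param ` Q = based_segments i0 \<inter> N" "\<And>q. q \<in> Q \<Longrightarrow> G (seg_param q) = q"
    using seg_param_local_inverse p assms(2) by blast
  have "open (N \<inter> G -` V)"
    using continuous_open_preimage[OF smooth_on_imp_continuous_on[OF Q(5)] Q(4) assms(1)] .
  moreover have "z \<in> N \<inter> G -` V" using p Q(2,6,7) by auto
  moreover have "smooth_on (N \<inter> G -` V) G" by (rule smooth_on_subset[OF Q(5)]) blast
  moreover have "G x = inv_into V seg_param x" if x: "x \<in> seg_param ` V \<inter> (N \<inter> G -` V)" for x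
  proof -
    have "x \<in> based_segments i0 \<inter> N" using x assms(2) by (auto simp flip: seg_param_image)
    then obtain q where "q \<in> Q" "x = seg_param q" unfolding Q(6)[symmetric] by blast
    then have "seg_param (G x) = x" by (simp add: Q(7))
    then show ?thesis using x assms(3) by (metis IntD2 inv_into_f_f vimageE)
  qed
  ultimately show "\<exists>U g. open U \<and> z \<in> U \<and> smooth_on U g \<and>
      (\<forall>x\<in>seg_param ` V \<inter> U. g x = inv_into V seg_param x)" by blast
qed

text \<open>Towards the segments, continuity of \<open>seg_param\<close> on the strip suffices by
  definition of the quotient. In the other direction, a preimage is the
  \<open>seg_param\<close>-image of an open subset of the cover, hence relatively open.\<close>

lemma homeomorphic_maps_mapping_torus:
  "homeomorphic_maps mapping_torus (top_of_set (based_segments i0)) seg_of_torus torus_of_seg"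
proof -
  have top: "topspace mapping_torus = torus_proj ` (torus_cover :: ((real ^ 'm) \<times> real) set)"
    by (simp add: topspace_mapping_torus torus_proj_image)
  have strip: "torus_strip \<subseteq> (torus_cover :: ((real ^ 'm) \<times> real) set)"
    by (auto simp: torus_strip_def torus_cover_def)
  have "continuous_map mapping_torus (top_of_set (based_segments i0)) seg_of_torus"
    unfolding continuous_map_def
  proof (intro conjI allI impI)
    show "seg_of_torus \<in> topspace mapping_torus \<rightarrow> topspace (top_of_set (based_segments i0))"
      by (auto simp: top seg_of_torus_proj simp flip: seg_param_image)
    fix U assume U: "openin (top_of_set (based_segments i0)) U"
    let ?W = "{c \<in> topspace mapping_torus. seg_of_torus c \<in> U}"
    have sub: "?W \<subseteq> torus_strip // torus_glue" by (auto simp: topspace_mapping_torus)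
    have "p \<in> \<Union>?W \<longleftrightarrow> p \<in> torus_strip \<inter> seg_param -` U" for p
    proof (cases "p \<in> torus_strip")
      case True
      then have "p \<in> torus_cover" using strip by blast
      then show ?thesis
        using torus_proj_mem_iff[OF sub True] True by (simp add: top seg_of_torus_proj)
    next
      case False
      moreover have "\<Union>(torus_strip // torus_glue) = (torus_strip :: ((real ^ 'm) \<times> real) set)"
        by (rule Union_quotient[OF equiv_torus_glue])
      ultimately show ?thesis using sub by blast
    qed
    then have "\<Union>?W = torus_strip \<inter> seg_param -` U" by blast
    moreover have "openin (top_of_set torus_strip) (torus_strip \<inter> seg_param -` U)"
    proof (rule continuous_openin_preimage[OF _ _ U])
      show "continuous_on torus_strip seg_param"
        by (rule continuous_on_subset[OF smooth_on_imp_continuous_on[OF smooth_on_seg_param[OF open_UNIV]]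
              subset_UNIV])
      show "seg_param \<in> torus_strip \<rightarrow> based_segments i0"
        using strip by (auto simp flip: seg_param_image)
    qed
    ultimately show "openin mapping_torus ?W"
      using sub by (simp add: openin_mapping_torus)
  qed
  moreover have "continuous_map (top_of_set (based_segments i0)) mapping_torus torus_of_seg"
    unfolding continuous_map_def
  proof (intro conjI allI impI)
    show "torus_of_seg \<in> topspace (top_of_set (based_segments i0)) \<rightarrow> topspace mapping_torus"
      by (auto simp: top torus_of_seg_param simp flip: seg_param_image)
    fix W :: "((real ^ 'm) \<times> real) set set" assume W: "openin mapping_torus W"
    have "{z \<in> topspace (top_of_set (based_segments i0)). torus_of_seg z \<in> W} =
        seg_param ` {p \<in> torus_cover. torus_proj p \<in> W}"
      by (auto simp: torus_of_seg_param simp flip: seg_param_image)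
    then show "openin (top_of_set (based_segments i0))
        {z \<in> topspace (top_of_set (based_segments i0)). torus_of_seg z \<in> W}"
      using openin_seg_param_image[OF open_torus_proj_vimage[OF W]] by simp
  qed
  moreover have "\<forall>c\<in>topspace mapping_torus. torus_of_seg (seg_of_torus c) = c"
    by (auto simp: top seg_of_torus_proj torus_of_seg_param)
  moreover have "\<forall>z\<in>topspace (top_of_set (based_segments i0)). seg_of_torus (torus_of_seg z) = z"
    by (auto simp: seg_of_torus_proj torus_of_seg_param simp flip: seg_param_image)
  ultimately show ?thesis by (simp add: homeomorphic_maps_def)
qed

section \<open>Smooth structures and coordinate expressions\<close>

text \<open>The representative \<open>p\<close> may lie outside \<open>V\<close>. A torus chart can
  thus be evaluated from any point of the orbit, which is the form in which transition maps present
  it.\<close>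

lemma inv_into_torus_proj:
  assumes "V \<subseteq> torus_cover" "inj_on torus_proj V" "p \<in> torus_cover" "seg_param p \<in> seg_param ` V"
  shows "inv_into V torus_proj (torus_proj p) = inv_into V seg_param (seg_param p)"
proof -
  obtain q where q: "q \<in> V" "seg_param p = seg_param q" using assms(4) by blast
  have "q \<in> torus_cover" using q(1) assms(1) by blast
  then have "torus_proj p = torus_proj q"
    using torus_proj_eq_iff_seg_param[OF assms(3)] q(2) by blast
  moreover have "inj_on seg_param V" using assms(2) inj_on_torus_proj_iff[OF assms(1)] by blast
  ultimately show ?thesis
    using q assms(2) by (simp add: inv_into_f_f)
qed

text \<open>Covers two coordinate expressions: \<open>f\<close> is the inverse of
  \<open>seg_param\<close> on a second chart for torus transitions, and a submanifold chart for
  \<open>seg_of_torus\<close>.\<close>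

lemma smooth_on_seg_param_chart:
  assumes "open V" "V \<subseteq> torus_cover" "openin (top_of_set (based_segments i0)) W" "smooth_on_subset W f"
  shows "open (V \<inter> seg_param -` W)" "smooth_on (V \<inter> seg_param -` W) (\<lambda>p. f (seg_param p))"
proof -
  have "openin (top_of_set V) (V \<inter> seg_param -` W)"
    by (rule continuous_openin_preimage[OF smooth_on_imp_continuous_on _ assms(3)])
       (use assms(1,2) smooth_on_seg_param in \<open>auto simp flip: seg_param_image\<close>)
  then show "open (V \<inter> seg_param -` W)" using assms(1) openin_open_trans by blast
  then show "smooth_on (V \<inter> seg_param -` W) (\<lambda>p. f (seg_param p))"
    by (intro smooth_on_subset_compose[OF assms(4)] smooth_on_seg_param) auto
qed

lemma mapping_torus_atlasE:
  assumes "(U, \<phi>) \<in> mapping_torus_atlas"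
  obtains V where "U = torus_proj ` V" "\<phi> = inv_into V torus_proj" "open V" "V \<subseteq> torus_cover"
    "inj_on torus_proj V" "inj_on seg_param V"
  using assms inj_on_torus_proj_iff unfolding mapping_torus_atlas_def by auto

lemma torus_chart_inverse:
  assumes "inj_on torus_proj V" "p \<in> V"
  shows "inv_into (torus_proj ` V) (inv_into V torus_proj) p = torus_proj p"
  using assms by (intro inv_into_f_eq) (auto simp: inj_on_inv_into)

lemma smooth_manifold_mapping_torus:
  "smooth_manifold (mapping_torus :: ((real ^ 'm) \<times> real) set topology) mapping_torus_atlas"
proof -
  let ?M = "top_of_set (based_segments i0)"
  \<comment> \<open>Both separation and countability are topological invariants and hold for
    subspaces of Euclidean space.\<close>
  note hom = homeomorphic_maps_mapping_torus
  then have "(mapping_torus :: ((real ^ 'm) \<times> real) set topology) homeomorphic_space ?M"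
    unfolding homeomorphic_space_def by (intro exI)
  then have "Hausdorff_space (mapping_torus :: ((real ^ 'm) \<times> real) set topology)"
    "second_countable (mapping_torus :: ((real ^ 'm) \<times> real) set topology)"
    by (simp_all add: homeomorphic_Hausdorff_space homeomorphic_space_second_countability
        Hausdorff_space_subtopology second_countable_subtopology second_countable_euclidean)
  moreover have "smooth_atlas (mapping_torus :: ((real ^ 'm) \<times> real) set topology) mapping_torus_atlas"
  proof (rule smooth_atlasI)
    fix c :: "((real ^ 'm) \<times> real) set" assume "c \<in> topspace mapping_torus"
    then obtain p where p: "p \<in> torus_cover" "c = torus_proj p"
      unfolding topspace_mapping_torus torus_proj_image[symmetric] by blast
    obtain Q N G where Q: "open Q" "p \<in> Q" "Q \<subseteq> torus_cover" "open N" "smooth_on N G"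
      "seg_param ` Q = based_segments i0 \<inter> N" "\<And>q. q \<in> Q \<Longrightarrow> G (seg_param q) = q"
      using seg_param_local_inverse p(1) by blast
    have "inj_on seg_param Q" by (rule inj_on_inverseI) (rule Q(7))
    then have "inj_on torus_proj Q" using inj_on_torus_proj_iff[OF Q(3)] by blast
    then have "(torus_proj ` Q, inv_into Q torus_proj) \<in> mapping_torus_atlas"
      using Q(1,3) unfolding mapping_torus_atlas_def by blast
    then show "\<exists>U \<phi>. (U, \<phi>) \<in> mapping_torus_atlas \<and> c \<in> U" using Q(2) p(2) by blast
  next
    fix U :: "((real ^ 'm) \<times> real) set set" and \<phi> assume "(U, \<phi>) \<in> mapping_torus_atlas"
    then obtain V where V: "U = torus_proj ` V" "\<phi> = inv_into V torus_proj" "open V"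
      "V \<subseteq> torus_cover" "inj_on torus_proj V" "inj_on seg_param V" by (rule mapping_torus_atlasE)
    have img: "inv_into V torus_proj ` torus_proj ` V = V"
      using V(5) by (simp add: inv_into_image_cancel)
    \<comment> \<open>Chart domains are open as images, under a homeomorphism, of relatively open
      sets of based segments.\<close>
    have "torus_proj ` V = torus_of_seg ` seg_param ` V"
      using V(4) torus_of_seg_param by (force simp: image_image)
    moreover have "homeomorphic_map ?M mapping_torus torus_of_seg"
      using hom homeomorphic_maps_map by blast
    ultimately have opn: "openin mapping_torus (torus_proj ` V)"
      using openin_seg_param_image[OF V(3,4)] homeomorphic_map_openness openin_subset by metis
    \<comment> \<open>Each direction factors through the based segments: the chart is the inverse of
      \<open>seg_param\<close> after \<open>seg_of_torus\<close>, and \<open>torus_proj\<close> is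
      \<open>torus_of_seg\<close> after \<open>seg_param\<close>.\<close>
    have "homeomorphic_maps (subtopology mapping_torus (torus_proj ` V)) (top_of_set V)
        (inv_into V torus_proj) torus_proj"
      unfolding homeomorphic_maps_def
    proof (intro conjI)
      have "continuous_map (subtopology mapping_torus (torus_proj ` V)) (top_of_set (seg_param ` V)) seg_of_torus"
        using hom V(4) seg_of_torus_proj unfolding homeomorphic_maps_def
        by (auto simp: continuous_map_in_subtopology continuous_map_from_subtopology image_subset_iff)
      moreover have "continuous_map (top_of_set (seg_param ` V)) (top_of_set V) (inv_into V seg_param)"
        using smooth_on_subset_imp_continuous_on[OF smooth_on_subset_inv_seg_param[OF V(3,4,6)]] V(6)
        by auto
      ultimately have "continuous_map (subtopology mapping_torus (torus_proj ` V)) (top_of_set V)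
          (inv_into V seg_param \<circ> seg_of_torus)" by (rule continuous_map_compose)
      then show "continuous_map (subtopology mapping_torus (torus_proj ` V)) (top_of_set V)
          (inv_into V torus_proj)"
        by (rule continuous_map_eq) (use V(4-6) seg_of_torus_proj in \<open>auto simp: inv_into_f_f subset_iff\<close>)
      have "continuous_map (top_of_set V) ?M seg_param"
        using V(3,4) smooth_on_imp_continuous_on[OF smooth_on_seg_param]
        by (auto simp flip: seg_param_image)
      then have "continuous_map (top_of_set V) mapping_torus (torus_of_seg \<circ> seg_param)"
        using hom unfolding homeomorphic_maps_def by (blast intro: continuous_map_compose)
      then have "continuous_map (top_of_set V) mapping_torus torus_proj"
        by (rule continuous_map_eq) (use V(4) torus_of_seg_param in auto)
      then show "continuous_map (top_of_set V) (subtopology mapping_torus (torus_proj ` V)) torus_proj"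
        by (simp add: continuous_map_in_subtopology)
    qed (use V(5) in \<open>auto simp: inv_into_f_f\<close>)
    then have "homeomorphic_map (subtopology mapping_torus (torus_proj ` V)) (top_of_set V)
        (inv_into V torus_proj)" using homeomorphic_maps_map by blast
    then show "openin mapping_torus U" "open (\<phi> ` U)"
      "homeomorphic_map (subtopology mapping_torus U) (top_of_set (\<phi> ` U)) \<phi>"
      using V(1-3) img opn by simp_all
  next
    fix U U' :: "((real ^ 'm) \<times> real) set set" and \<phi> \<phi>'
    assume "(U, \<phi>) \<in> mapping_torus_atlas" and U': "(U', \<phi>') \<in> mapping_torus_atlas"
    then obtain V where V: "U = torus_proj ` V" "\<phi> = inv_into V torus_proj" "open V"
      "V \<subseteq> torus_cover" "inj_on torus_proj V" "inj_on seg_param V" by (elim mapping_torus_atlasE)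
    obtain V' where V': "U' = torus_proj ` V'" "\<phi>' = inv_into V' torus_proj" "open V'"
      "V' \<subseteq> torus_cover" "inj_on torus_proj V'" "inj_on seg_param V'"
      using U' by (rule mapping_torus_atlasE)
    \<comment> \<open>The overlap in coordinates: the points of \<open>V\<close> whose orbit also
      meets \<open>V'\<close>. The transition map sends such a point to the representative in
      \<open>V'\<close>.\<close>
    let ?S = "V \<inter> seg_param -` seg_param ` V'"
    have S: "open ?S" "smooth_on ?S (\<lambda>p. inv_into V' seg_param (seg_param p))"
      using smooth_on_seg_param_chart[OF V(3,4) openin_seg_param_image[OF V'(3,4)]
          smooth_on_subset_inv_seg_param[OF V'(3,4,6)]] by blast+
    have "torus_proj ` V \<inter> torus_proj ` V' = torus_proj ` ?S"
      using V(4) V'(4) torus_proj_eq_iff_seg_param by (fastforce simp: image_iff subset_iff)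
    then have dom: "inv_into V torus_proj ` (torus_proj ` V \<inter> torus_proj ` V') = ?S"
      using V(5) by (simp add: inv_into_image_cancel)
    have "smooth_on ?S (\<lambda>p. inv_into V' torus_proj (inv_into (torus_proj ` V) (inv_into V torus_proj) p))"
      using S(2)
    proof (rule smooth_on_cong[OF S(1), THEN iffD1, rotated])
      fix p assume p: "p \<in> ?S"
      then have "p \<in> torus_cover" using V(4) by blast
      then show "inv_into V' seg_param (seg_param p) =
          inv_into V' torus_proj (inv_into (torus_proj ` V) (inv_into V torus_proj) p)"
        using p inv_into_torus_proj[OF V'(4,5)] torus_chart_inverse[OF V(5)] by simp
    qed
    then show "smooth_on (\<phi> ` (U \<inter> U')) (\<lambda>x. \<phi>' (inv_into U \<phi> x))"
      using V(1,2) V'(1,2) dom by simp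
  qed
  ultimately show ?thesis by (simp add: smooth_manifold_def)
qed

lemma smooth_manifold_based_segments:
  assumes "CARD('n) = CARD('m) + 1"
  shows "smooth_manifold (top_of_set (based_segments i0))
    (submanifold_atlas (based_segments i0) :: (complex ^ 'n, real ^ 'n) chart set)"
proof (rule smooth_manifold_submanifold_atlas)
  \<comment> \<open>Local inverses take values in \<open>(real ^ 'm) \<times> real\<close>, but the
    model space is \<open>real ^ 'n\<close>; a linear isomorphism \<open>l\<close> makes the passage
    and is smooth both ways.\<close>
  have "DIM((real ^ 'm) \<times> real) = DIM(real ^ 'n)" using assms by simp
  then obtain l :: "(real ^ 'm) \<times> real \<Rightarrow> real ^ 'n" and l' where l: "linear l" "linear l'"
    "\<And>x. l' (l x) = x" "\<And>y. l (l' y) = y" using isomorphisms_UNIV_UNIV by metis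
  fix z assume "z \<in> based_segments i0"
  then obtain p where p: "p \<in> torus_cover" "z = seg_param p" by (auto simp flip: seg_param_image)
  obtain Q N G where Q: "open Q" "p \<in> Q" "Q \<subseteq> torus_cover" "open N" "smooth_on N G"
    "seg_param ` Q = based_segments i0 \<inter> N" "\<And>q. q \<in> Q \<Longrightarrow> G (seg_param q) = q"
    using seg_param_local_inverse p(1) by blast
  let ?U = "seg_param ` Q" and ?\<phi> = "\<lambda>z. l (G z)"
  have img: "?\<phi> ` ?U = l ` Q" using Q(7) by (force simp: image_image)
  have "l ` Q = l' -` Q" using l(3,4) by (auto simp: image_iff) metis
  then have opn: "open (l ` Q)"
    using Q(1) l(2) by (metis linear_continuous_on linear_conv_bounded_linear open_vimage)
  have inj: "inj_on ?\<phi> ?U" 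
  proof (rule inj_onI)
    fix x y assume "x \<in> ?U" "y \<in> ?U" and eq: "l (G x) = l (G y)"
    then obtain a b where "a \<in> Q" "x = seg_param a" "b \<in> Q" "y = seg_param b" by blast
    moreover have "G x = G y" using arg_cong[OF eq, of l'] by (simp add: l(3))
    ultimately show "x = y" by (simp add: Q(7))
  qed
  have "smooth_on N ?\<phi>"
    by (rule smooth_on_linear_compose[OF _ Q(4,5)]) (use l(1) linear_conv_bounded_linear in blast)
  then have "smooth_on_subset ?U ?\<phi>"
    unfolding smooth_on_subset_def
    by (intro ballI exI[of _ N] exI[of _ ?\<phi>] conjI Q(4)) (use Q(6) in auto)
  moreover have "smooth_on (l ` Q) (inv_into ?U ?\<phi>)"
  proof (rule smooth_on_cong[OF opn, THEN iffD1])
    show "smooth_on (l ` Q) (\<lambda>x. seg_param (l' x))"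
      using smooth_on_linear[OF _ opn] l(2) linear_conv_bounded_linear
      by (intro smooth_on_compose[OF opn open_UNIV _ _ smooth_on_seg_param[OF open_UNIV]]) auto
    show "seg_param (l' x) = inv_into ?U ?\<phi> x" if x: "x \<in> l ` Q" for x
      by (rule inv_into_f_eq[symmetric, OF inj]) (use x Q(7) l(3) in auto)
  qed
  ultimately have "(?U, ?\<phi>) \<in> submanifold_atlas (based_segments i0)"
    unfolding submanifold_atlas_def
    using openin_seg_param_image[OF Q(1,3)] inj opn img by simp
  then show "\<exists>U (\<phi> :: complex ^ 'n \<Rightarrow> real ^ 'n). (U, \<phi>) \<in> submanifold_atlas (based_segments i0) \<and> z \<in> U"
    using p(2) Q(2) by blast
qed

text \<open>In coordinates this is an inverse submanifold chart followed by an inverse of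
  \<open>seg_param\<close>; the projection drops out because the fibres agree.\<close>

lemma smooth_map_torus_of_seg:
  "smooth_map (top_of_set (based_segments i0)) (submanifold_atlas (based_segments i0))
    mapping_torus mapping_torus_atlas torus_of_seg"
proof (rule smooth_mapI)
  show "continuous_map (top_of_set (based_segments i0)) mapping_torus torus_of_seg"
    using homeomorphic_maps_mapping_torus by (simp add: homeomorphic_maps_def)
  fix U :: "(complex ^ 'n) set" and W :: "((real ^ 'm) \<times> real) set set" and \<phi> \<psi>
  assume U: "(U, \<phi>) \<in> submanifold_atlas (based_segments i0)" and "(W, \<psi>) \<in> mapping_torus_atlas"
  then obtain V where V: "W = torus_proj ` V" "\<psi> = inv_into V torus_proj" "open V"
    "V \<subseteq> torus_cover" "inj_on torus_proj V" "inj_on seg_param V" by (elim mapping_torus_atlasE)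
  let ?S = "\<phi> ` (U \<inter> seg_param ` V)"
  have S: "open ?S"
    by (rule open_submanifold_chart_image[OF U openin_seg_param_image[OF V(3,4)]])
  have dom: "U \<inter> torus_of_seg -` torus_proj ` V = U \<inter> seg_param ` V"
  proof -
    have "torus_of_seg x \<in> torus_proj ` V \<longleftrightarrow> x \<in> seg_param ` V" if "x \<in> U" for x
    proof -
      have "x \<in> based_segments i0" using that submanifold_atlasD(2)[OF U] by blast
      then obtain p where p: "p \<in> torus_cover" "x = seg_param p" by (auto simp flip: seg_param_image)
      have "torus_proj p = torus_proj q \<longleftrightarrow> seg_param p = seg_param q" if "q \<in> V" for q
        using torus_proj_eq_iff_seg_param[OF p(1)] V(4) that by blast
      then show ?thesis
        unfolding p(2) torus_of_seg_param[OF p(1)] image_iff by blast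
    qed
    then show ?thesis by blast
  qed
  have "smooth_on ?S (\<lambda>x. inv_into V seg_param (inv_into U \<phi> x))"
    by (rule smooth_on_submanifold_chart[OF U openin_seg_param_image[OF V(3,4)]
          smooth_on_subset_inv_seg_param[OF V(3,4,6)]])
  then have "smooth_on ?S (\<lambda>x. inv_into V torus_proj (torus_of_seg (inv_into U \<phi> x)))"
  proof (rule smooth_on_cong[OF S, THEN iffD1, rotated])
    fix x assume "x \<in> ?S"
    then obtain y p where y: "y \<in> U" "x = \<phi> y" and p: "p \<in> V" "y = seg_param p" by blast
    have "inv_into U \<phi> x = seg_param p"
      using y p submanifold_atlasD(4)[OF U] by (simp add: inv_into_f_f)
    moreover have "torus_of_seg (seg_param p) = torus_proj p" using p V(4) torus_of_seg_param by blast
    ultimately show "inv_into V seg_param (inv_into U \<phi> x) =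
        inv_into V torus_proj (torus_of_seg (inv_into U \<phi> x))"
      using p(1) V(5,6) by (simp add: inv_into_f_f)
  qed
  then show "smooth_on (\<phi> ` (U \<inter> torus_of_seg -` W)) (\<lambda>x. \<psi> (torus_of_seg (inv_into U \<phi> x)))"
    using V(1,2) dom by simp
qed

text \<open>In coordinates this is \<open>seg_param\<close> followed by a submanifold chart.\<close>

lemma smooth_map_seg_of_torus:
  "smooth_map mapping_torus mapping_torus_atlas
    (top_of_set (based_segments i0)) (submanifold_atlas (based_segments i0)) seg_of_torus"
proof (rule smooth_mapI)
  show "continuous_map mapping_torus (top_of_set (based_segments i0)) seg_of_torus"
    using homeomorphic_maps_mapping_torus by (simp add: homeomorphic_maps_def)
  fix U :: "(complex ^ 'n) set" and W :: "((real ^ 'm) \<times> real) set set" and \<phi> \<psi>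
  assume U: "(U, \<phi>) \<in> submanifold_atlas (based_segments i0)" and "(W, \<psi>) \<in> mapping_torus_atlas"
  then obtain V where V: "W = torus_proj ` V" "\<psi> = inv_into V torus_proj" "open V"
    "V \<subseteq> torus_cover" "inj_on torus_proj V" "inj_on seg_param V" by (elim mapping_torus_atlasE)
  let ?S = "V \<inter> seg_param -` U"
  have S: "open ?S" "smooth_on ?S (\<lambda>p. \<phi> (seg_param p))"
    by (rule smooth_on_seg_param_chart[OF V(3,4) submanifold_atlasD(1,5)[OF U]])+
  have "torus_proj ` V \<inter> seg_of_torus -` U = torus_proj ` ?S"
    using V(4) seg_of_torus_proj by (auto simp: subset_iff)
  then have dom: "inv_into V torus_proj ` (torus_proj ` V \<inter> seg_of_torus -` U) = ?S"
    using V(5) by (simp add: inv_into_image_cancel)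
  have "smooth_on ?S (\<lambda>p. \<phi> (seg_of_torus (inv_into (torus_proj ` V) (inv_into V torus_proj) p)))"
    using S(2)
  proof (rule smooth_on_cong[OF S(1), THEN iffD1, rotated])
    fix p assume p: "p \<in> ?S"
    then have "seg_of_torus (torus_proj p) = seg_param p" using V(4) seg_of_torus_proj by blast
    then show "\<phi> (seg_param p) =
        \<phi> (seg_of_torus (inv_into (torus_proj ` V) (inv_into V torus_proj) p))"
      using p torus_chart_inverse[OF V(5)] by simp
  qed
  then show "smooth_on (\<psi> ` (W \<inter> seg_of_torus -` U)) (\<lambda>x. \<phi> (seg_of_torus (inv_into W \<psi> x)))"
    using V(1,2) dom by simp
qed

end

theorem theorem2p1:
  fixes i0 :: "'n::finite"
  assumes "CARD('n) \<ge> 3"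
    and "CARD('n) = CARD('m::finite) + 1"
  shows "smooth_submanifold CARD('n) (based_segments i0) \<and>
    diffeomorphic
      (top_of_set (based_segments i0))
      (submanifold_atlas (based_segments i0) :: (complex ^ 'n, real ^ 'n) chart set)
      (mapping_torus :: ((real ^ 'm) \<times> real) set topology)
      mapping_torus_atlas"
proof -
  \<comment> \<open>Any enumeration of the indices other than \<open>i0\<close> will do; the
    cardinality assumption provides one.\<close>
  have "card (UNIV :: 'm set) = card (- {i0})"
    using assms(2) by (simp add: Compl_eq_Diff_UNIV card_Diff_singleton)
  then obtain e :: "'m \<Rightarrow> 'n" where "bij_betw e UNIV (- {i0})"
    using finite_same_card_bij[of "UNIV :: 'm set" "- {i0}"] by auto
  then interpret coordinate_complement e i0
    by unfold_locales (auto simp: bij_betw_def)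
  have "diffeomorphic
      (top_of_set (based_segments i0))
      (submanifold_atlas (based_segments i0) :: (complex ^ 'n, real ^ 'n) chart set)
      (mapping_torus :: ((real ^ 'm) \<times> real) set topology)
      mapping_torus_atlas"
    unfolding diffeomorphic_def
    using homeomorphic_maps_mapping_torus unfolding homeomorphic_maps_def
    by (intro conjI exI[of _ torus_of_seg] exI[of _ seg_of_torus] smooth_manifold_mapping_torus
        smooth_manifold_based_segments[OF assms(2)] smooth_map_torus_of_seg smooth_map_seg_of_torus)
      auto
  then show ?thesis using smooth_submanifold_based_segments by blast
qed

end
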